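(* For every $\varepsilon>0$, every squarefree monic $Q\in\mathbb F_q[T]$ and every integer $h\ge0$, \[m_5(Q;h)\ll_\varepsilon|Q|\,q^{(2+\varepsilon)h}\Big(\frac{|Q|}{\phi(Q)}\Big)^{-4}+|Q|\,q^{2h}\Big(\frac{|Q|}{\phi(Q)}\Big)^{27}.\]
   Context: $\mathbb F_q$ is a fixed finite field with $q$ elements. For nonzero $F\in\mathbb F_q[T]$, $|F|=q^{\deg F}$, $|0|=0$. For monic $Q$, $\phi(Q)$ is the number of polynomials $A$ with $\deg A<\deg Q$, $\gcd(A,Q)=1$. With $I(F,h)=\{G\in\mathbb F_q[T]:|F-G|<q^h\}$, \[m_5(Q;h)=\sum_{F\bmod Q}\Big(\#\{G\in I(F,h):\gcd(G,Q)=1\}-\frac{q^h\phi(Q)}{|Q|}\Big)^5,\] $F$ ranging over polynomials with $\deg F<\deg Q$. The implied constant depends only on $\varepsilon$ and $q$. *)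

theory Defs
  imports
    Complex_Main
    "HOL-Library.Cardinality"
    "HOL-Computational_Algebra.Polynomial"
    "HOL-Computational_Algebra.Squarefree"
begin

text \<open>
  The field with \<open>q\<close> elements is a type \<open>'a\<close> of sort \<open>{finite, field}\<close>, with \<open>q = CARD('a)\<close>.
  In the library \<open>degree 0 = 0\<close>, so size conditions are stated with the absolute value below,
  for which the zero polynomial has absolute value 0. For nonzero \<open>Q\<close>, \<open>degree A < degree Q\<close> under
  the convention that 0 has degree minus infinity is \<open>poly_abs A < poly_abs Q\<close>; in particular
  the only residue modulo \<open>Q = 1\<close> is 0.
\<close>

definition poly_abs :: "'a::{finite,field} poly \<Rightarrow> nat" where
  "poly_abs F = (if F = 0 then 0 else CARD('a) ^ degree F)"

definition residues_mod :: "'a::{finite,field} poly \<Rightarrow> 'a poly set" where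
  "residues_mod Q = {F. poly_abs F < poly_abs Q}"

definition poly_phi :: "'a::{finite,field} poly \<Rightarrow> nat" where
  "poly_phi Q = card {A \<in> residues_mod Q. coprime A Q}"

definition short_interval :: "'a::{finite,field} poly \<Rightarrow> nat \<Rightarrow> 'a poly set" where
  "short_interval F h = {G. poly_abs (F - G) < CARD('a) ^ h}"

definition reduced_moment :: "nat \<Rightarrow> 'a::{finite,field} poly \<Rightarrow> nat \<Rightarrow> real" where
  "reduced_moment k Q h =
     (\<Sum>F\<in>residues_mod Q.
        (real (card {G \<in> short_interval F h. coprime G Q})
          - real (CARD('a) ^ h) * real (poly_phi Q) / real (poly_abs Q)) ^ k)"

text \<open>The index sets are finite, so \<open>card\<close> and \<open>sum\<close> do not take their default values.\<close>

lemma finite_poly_abs_less: "finite {F :: 'a::{finite,field} poly. poly_abs F < n}"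
proof -
  have q: "2 \<le> CARD('a)"
    using card_mono[of "UNIV :: 'a set" "{0, 1}"] by simp
  have "length (coeffs F) \<le> n" if "poly_abs F < n" for F :: "'a poly"
  proof (cases "F = 0")
    case False
    have "degree F < 2 ^ degree F" by simp
    also have "\<dots> \<le> CARD('a) ^ degree F" using q by (rule power_mono) simp
    finally show ?thesis using that False by (simp add: poly_abs_def length_coeffs)
  qed simp
  then have "{F :: 'a poly. poly_abs F < n} \<subseteq> Poly ` {xs. set xs \<subseteq> UNIV \<and> length xs \<le> n}"
    by (auto intro!: image_eqI[where x = "coeffs _"])
  then show ?thesis
    by (rule finite_subset) (intro finite_imageI finite_lists_length_le, simp)
qed

lemma finite_residues_mod: "finite (residues_mod Q)"
  unfolding residues_mod_def by (rule finite_poly_abs_less)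

lemma finite_short_interval: "finite (short_interval F h)"
proof -
  have "short_interval F h \<subseteq> (\<lambda>H. F - H) ` {H. poly_abs H < CARD('a) ^ h}"
    unfolding short_interval_def by (auto intro!: image_eqI[where x = "F - _"])
  then show ?thesis
    by (rule finite_subset) (intro finite_imageI finite_poly_abs_less)
qed

end

theory Submission
  imports Defs "HOL-Computational_Algebra.Polynomial_Factorial" "HOL-Number_Theory.Cong"
begin

text \<open>
  Expanding the indicator function of coprimality in additive characters modulo \<open>Q\<close>, the kernel of
  the short interval is \<open>q ^ h\<close> times the indicator of the frequencies \<open>a/Q\<close> with
  \<open>deg a < deg Q - h\<close>. Hence the fifth moment is at most \<open>|Q| q ^ (5 h) (\<phi>(Q)/|Q|) ^ 5\<close> times the sum of
  the products of the weights \<open>1/\<phi>(R\<^sub>i)\<close>, where \<open>R\<^sub>i\<close> is the reduced denominator of the \<open>i\<close>-th frequency,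
  over five nonzero frequencies adding up to zero.

  Group the five as \<open>\<beta> = \<alpha>\<^sub>1 + \<alpha>\<^sub>2\<close>, \<open>\<alpha>\<^sub>3\<close> and \<open>\<gamma> = \<alpha>\<^sub>4 + \<alpha>\<^sub>5\<close>. The weighted number of representations of \<open>\<gamma>\<close>
  as a sum of two is bounded by a weight of \<open>\<gamma>\<close> of the same type. Let \<open>\<beta> = B/(kcm)\<close>, \<open>\<alpha>\<^sub>3 = A/(kcy)\<close> and
  \<open>\<gamma> = G/(kmy)\<close>, and assume by symmetry that \<open>\<gamma>\<close> has the larger denominator, so that \<open>|y| \<ge> |c|\<close>. For
  fixed \<open>\<beta>\<close>, if \<open>|ky| \<ge> q ^ h\<close>, then the number of admissible \<open>A\<close> is at most the expected \<open>|ky|/q ^ h\<close>. Otherwise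
  choose \<open>A\<close> first: then \<open>By + Am \<equiv> 0\<close> determines \<open>y\<close> modulo \<open>c\<close>, which gives the expected number of pairs
  \<open>(A, y)\<close>, and only the number of prime factors of \<open>y\<close> costs a factor \<open>q ^ (\<epsilon>h)\<close>. What remains is a sum
  over \<open>\<alpha>\<^sub>1 + \<alpha>\<^sub>2 = \<beta>\<close>, to which the same bound applies once the smaller denominator is fixed. Each of
  the two steps and the final diagonal sum save a factor \<open>q ^ h\<close>.

  All frequencies have squarefree denominators, so divisors of \<open>Q\<close> are encoded as subsets of its set of
  monic prime factors, and \<open>a/Q\<close> has as denominator the product of the primes that do not divide \<open>a\<close>.
\<close>

section \<open>Additive characters of a finite field\<close>

text \<open>A maximal additive subgroup \<open>H\<close> avoiding 1 has index p =
  \<open>CHAR('a)\<close>: every element is congruent modulo \<open>H\<close> to an integer multiple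
  of 1, unique modulo p, and the character sends it to the matching p-th root of unity. No trace map
  to the prime field is involved.\<close>

lemma exists_nontrivial_additive_character:
  "\<exists>\<psi> :: 'a::{finite,field} \<Rightarrow> complex. \<psi> 0 = 1 \<and> (\<forall>x y. \<psi> (x + y) = \<psi> x * \<psi> y) \<and> (\<exists>x. \<psi> x \<noteq> 1)"
proof -
  let ?p = "CHAR('a)"
  have p: "prime ?p"
    by (rule prime_CHAR_semidom) (simp add: finite_imp_CHAR_pos)
  define \<H> where "\<H> = {H :: 'a set. 0 \<in> H \<and> (\<forall>x\<in>H. \<forall>y\<in>H. x - y \<in> H) \<and> 1 \<notin> H}"
  have "finite \<H>" "{0} \<in> \<H>"
    by (auto simp: \<H>_def)
  then have "Max (card ` \<H>) \<in> card ` \<H>"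
    by (intro Max_in) auto
  then obtain H where H: "H \<in> \<H>" and "card H = Max (card ` \<H>)"
    by (metis imageE)
  then have Hmax: "\<And>H'. H' \<in> \<H> \<Longrightarrow> card H' \<le> card H"
    using \<open>finite \<H>\<close> by simp
  have H0: "0 \<in> H" and Hdiff: "\<And>x y. x \<in> H \<Longrightarrow> y \<in> H \<Longrightarrow> x - y \<in> H" and H1: "1 \<notin> H"
    using H by (auto simp: \<H>_def)
  have Hneg: "- x \<in> H" if "x \<in> H" for x
    using Hdiff[OF H0 that] by simp
  have Hadd: "x + y \<in> H" if "x \<in> H" "y \<in> H" for x y
    using Hdiff[OF that(1) Hneg[OF that(2)]] by simp
  have Hnat: "of_nat k * x \<in> H" if "x \<in> H" for k x
    by (induction k) (auto simp: algebra_simps H0 that intro: Hadd)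
  have Hint: "of_int k * x \<in> H" if "x \<in> H" for k x
    using Hnat[OF that] Hneg[OF Hnat[OF that]] by (cases k) (auto simp del: of_nat_Suc)
  have inverse_mod: "\<exists>l. (of_int l * of_int k :: 'a) = 1" if "\<not> int ?p dvd k" for k
  proof -
    have "coprime k (int ?p)"
      using prime_imp_coprime[of "int ?p" k] that p by (simp add: coprime_commute)
    then obtain l where "[k * l = 1] (mod int ?p)"
      using coprime_iff_invertible_int by blast
    then have "of_int (k * l) = (of_int 1 :: 'a)"
      unfolding of_int_eq_iff_cong_CHAR .
    then show ?thesis by (intro exI[of _ l]) (simp add: mult.commute)
  qed
  have cover: "\<exists>k. y - of_int k \<in> H" for y
  proof (cases "y \<in> H")
    case False
    \<comment> \<open>Adjoining \<open>y\<close> must bring in 1, by maximality of \<open>H\<close>.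
      In \<open>1 = u + of_int k * y\<close> the integer \<open>k\<close> is invertible modulo p,
      and solving for \<open>y\<close> gives its integer representative.\<close>
    define H' where "H' = {u + of_int k * y | u k. u \<in> H}"
    have sub: "H \<subseteq> H'" using H0 by (force simp: H'_def intro: exI[of _ "0::int"])
    moreover have "y \<in> H'" unfolding H'_def using H0 by (auto intro!: exI[of _ 0] exI[of _ "1::int"])
    ultimately have "card H < card H'"
      using False by (intro psubset_card_mono) auto
    then have "H' \<notin> \<H>" using Hmax by fastforce
    moreover have "u + of_int k * y - (u' + of_int k' * y) \<in> H'" if "u \<in> H" "u' \<in> H" for u u' k k'
      unfolding H'_def using Hdiff[OF that]
      by (intro CollectI exI[of _ "u - u'"] exI[of _ "k - k'"]) (auto simp: algebra_simps)
    then have "\<forall>x\<in>H'. \<forall>z\<in>H'. x - z \<in> H'"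
      by (fastforce simp: H'_def)
    ultimately have "1 \<in> H'" using sub H0 by (auto simp: \<H>_def)
    then obtain u k where uk: "u \<in> H" "1 = u + of_int k * y" by (auto simp: H'_def)
    have "\<not> int ?p dvd k"
      using uk H1 by (metis add.right_neutral mult_zero_left of_int_eq_0_iff_char_dvd)
    then obtain l where "(of_int l * of_int k :: 'a) = 1" using inverse_mod by blast
    then have "y - of_int l = - (of_int l * u)"
      using arg_cong[OF uk(2), of "\<lambda>z. of_int l * z"] by (simp add: algebra_simps flip: mult.assoc)
    then show ?thesis using Hneg[OF Hint[OF uk(1)]] by metis
  qed (auto intro: exI[of _ 0])
  have unique: "int ?p dvd k" if "of_int k \<in> H" for k
    using inverse_mod[of k] Hint[OF that] H1 by metis
  define \<kappa> where "\<kappa> y = (SOME k. y - of_int k \<in> H)" for y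
  have \<kappa>: "y - of_int (\<kappa> y) \<in> H" for y
    unfolding \<kappa>_def by (rule someI_ex[OF cover])
  define \<psi> where "\<psi> y = cis (2 * pi * of_int (\<kappa> y) / of_nat ?p)" for y
  have pne: "real ?p \<noteq> 0" using p by auto
  have \<psi>_eq: "\<psi> y = cis (2 * pi * of_int k / of_nat ?p)" if "y - of_int k \<in> H" for y k
  proof -
    have "of_int (\<kappa> y - k) \<in> H"
      using Hdiff[OF that \<kappa>[of y]] by simp
    from unique[OF this] obtain m where "\<kappa> y - k = int ?p * m" by (rule dvdE)
    then have "\<kappa> y = k + int ?p * m" by simp
    then have "2 * pi * of_int (\<kappa> y) / of_nat ?p = 2 * pi * of_int k / of_nat ?p + 2 * pi * of_int m"
      using pne by (simp add: field_simps)
    then show ?thesis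
      unfolding \<psi>_def by (simp only: cis_mult[symmetric] cis_multiple_2pi[OF Ints_of_int] mult_1_right)
  qed
  have "\<psi> (x + y) = \<psi> x * \<psi> y" for x y
  proof -
    have "x + y - of_int (\<kappa> x + \<kappa> y) \<in> H"
      using Hadd[OF \<kappa>[of x] \<kappa>[of y]] by (simp add: algebra_simps)
    from \<psi>_eq[OF this] show ?thesis
      by (simp add: \<psi>_def cis_mult add_divide_distrib distrib_left)
  qed
  moreover have "\<psi> 1 \<noteq> 1"
  proof
    assume "\<psi> 1 = 1"
    moreover have "\<psi> 1 = cis (2 * pi / of_nat ?p)"
      using \<psi>_eq[of 1 1] H0 by simp
    ultimately have "cos (2 * pi / of_nat ?p) = 1" by (metis cis.sel(1) one_complex.sel(1))
    then obtain m :: int where "2 * pi / of_nat ?p = of_int m * 2 * pi"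
      by (auto simp: cos_one_2pi_int)
    then have "real_of_int (m * int ?p) = 1" using pne by (simp add: field_simps)
    then have "m * int ?p = 1" by linarith
    then have "int ?p dvd 1" by (metis dvd_triv_right)
    then show False using p by (auto dest: prime_gt_1_nat)
  qed
  moreover have "\<psi> 0 = 1"
    using \<psi>_eq[of 0 0] H0 by simp
  ultimately show ?thesis by blast
qed

section \<open>Additive characters modulo a polynomial\<close>

text \<open>Stated by coefficients so that 0 belongs to it for every t, despite
  \<open>degree 0 = 0\<close>. Through truncated subtraction \<open>lowdeg (degree Q - h)\<close> is
  just {0} once \<open>h \<ge> degree Q\<close>.\<close>

definition lowdeg :: "nat \<Rightarrow> 'a::zero poly set" where
  "lowdeg t = {a. \<forall>i\<ge>t. coeff a i = 0}"

lemma lowdeg_iff: "a \<in> lowdeg t \<longleftrightarrow> a = 0 \<or> degree a < t"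
proof (cases "a = 0")
  case False
  then show ?thesis
    unfolding lowdeg_def
    by (auto simp: coeff_eq_0) (metis leading_coeff_0_iff linorder_not_less)
qed (simp add: lowdeg_def)

lemma lowdeg_0 [simp]: "lowdeg 0 = {0}"
  by (auto simp: lowdeg_iff)

lemma zero_in_lowdeg [simp, intro]: "0 \<in> lowdeg t"
  by (simp add: lowdeg_def)

lemma lowdeg_add [intro]: "a \<in> lowdeg t \<Longrightarrow> b \<in> lowdeg t \<Longrightarrow> a + b \<in> lowdeg t"
  by (simp add: lowdeg_def)

lemma lowdeg_diff [intro]:
  fixes a b :: "'a::ab_group_add poly"
  shows "a \<in> lowdeg t \<Longrightarrow> b \<in> lowdeg t \<Longrightarrow> a - b \<in> lowdeg t"
  by (simp add: lowdeg_def)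

lemma lowdeg_uminus [simp]:
  fixes a :: "'a::ab_group_add poly"
  shows "- a \<in> lowdeg t \<longleftrightarrow> a \<in> lowdeg t"
  by (simp add: lowdeg_def)

lemma lowdeg_mono: "s \<le> t \<Longrightarrow> lowdeg s \<subseteq> lowdeg t"
  by (auto simp: lowdeg_def)

lemma lowdeg_Suc:
  "lowdeg (Suc t) = (\<lambda>(c, a). pCons c a) ` (UNIV \<times> lowdeg t)"
proof (intro equalityI subsetI)
  fix a :: "'a poly" assume a: "a \<in> lowdeg (Suc t)"
  obtain c b where ab: "a = pCons c b" by (cases a)
  have "coeff b i = 0" if "i \<ge> t" for i
    using a that unfolding lowdeg_def ab by (auto dest!: spec[of _ "Suc i"])
  then show "a \<in> (\<lambda>(c, a). pCons c a) ` (UNIV \<times> lowdeg t)"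
    unfolding ab lowdeg_def by force
qed (auto simp: lowdeg_def coeff_pCons split: nat.split)

lemma finite_lowdeg [simp, intro]: "finite (lowdeg t :: 'a::{finite,zero} poly set)"
  by (induction t) (simp_all add: lowdeg_Suc)

lemma card_lowdeg: "card (lowdeg t :: 'a::{finite,zero} poly set) = CARD('a) ^ t"
proof (induction t)
  case (Suc t)
  have "inj_on (\<lambda>(c, a). pCons c a) (UNIV \<times> (lowdeg t :: 'a poly set))"
    by (auto simp: inj_on_def)
  then show ?case
    using Suc by (simp add: lowdeg_Suc card_image card_cartesian_product)
qed simp

text \<open>Division by \<open>M\<close>. Truncated subtraction keeps the formula right for
  \<open>degree M \<ge> t\<close>, where 0 is the only multiple.\<close>

lemma card_multiples_lowdeg:
  fixes M :: "'a::{finite,field} poly"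
  assumes "M \<noteq> 0"
  shows "card {a \<in> lowdeg t. M dvd a} = CARD('a) ^ (t - degree M)"
proof -
  have "{a \<in> lowdeg t. M dvd a} = (\<lambda>e. M * e) ` lowdeg (t - degree M)"
  proof (intro equalityI subsetI)
    fix a assume "a \<in> {a \<in> lowdeg t. M dvd a}"
    then obtain e where "a = M * e" "M * e \<in> lowdeg t" by (auto elim!: dvdE)
    moreover have "e \<in> lowdeg (t - degree M)"
      using calculation assms by (cases "e = 0") (auto simp: lowdeg_iff degree_mult_eq)
    ultimately show "a \<in> (\<lambda>e. M * e) ` lowdeg (t - degree M)" by blast
  next
    fix a assume "a \<in> (\<lambda>e. M * e) ` lowdeg (t - degree M)"
    then obtain e where e: "e \<in> lowdeg (t - degree M)" "a = M * e" by blast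
    then show "a \<in> {a \<in> lowdeg t. M dvd a}"
      using assms by (cases "e = 0") (auto simp: lowdeg_iff degree_mult_eq)
  qed
  moreover have "inj_on (\<lambda>e. M * e) (lowdeg (t - degree M))"
    using assms by (auto simp: inj_on_def)
  ultimately show ?thesis
    by (simp add: card_image card_lowdeg)
qed

text \<open>Subtracting one member of \<open>A\<close> carries \<open>A\<close> into the multiples
  of \<open>M\<close>. The bound never drops below 1, so wherever fewer than one element is
  expected, emptiness has to be shown separately.\<close>

lemma card_congruent_lowdeg_le:
  fixes M :: "'a::{finite,field} poly"
  assumes "M \<noteq> 0" and "\<And>x y. x \<in> A \<Longrightarrow> y \<in> A \<Longrightarrow> x - y \<in> lowdeg t \<and> M dvd x - y"
  shows "finite A" and "card A \<le> CARD('a) ^ (t - degree M)"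
proof -
  have "finite A \<and> card A \<le> CARD('a) ^ (t - degree M)"
  proof (cases "A = {}")
    case False
    then obtain x where x: "x \<in> A" by blast
    have inj: "inj_on (\<lambda>y. y - x) A" by (auto simp: inj_on_def)
    have sub: "(\<lambda>y. y - x) ` A \<subseteq> {a \<in> lowdeg t. M dvd a}"
      using assms(2) x by blast
    have "finite {a \<in> lowdeg t. M dvd a}" by simp
    then show ?thesis
      using card_inj_on_le[OF inj sub] inj_on_finite[OF inj sub]
      by (simp add: card_multiples_lowdeg[OF assms(1)])
  qed simp
  then show "finite A" "card A \<le> CARD('a) ^ (t - degree M)" by auto
qed

lemma sum_nontrivial_character:
  fixes \<chi> :: "'b::ab_group_add \<Rightarrow> complex"
  assumes "finite G" and "\<And>x y. x \<in> G \<Longrightarrow> y \<in> G \<Longrightarrow> x - y \<in> G"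
    and "\<And>x y. \<chi> (x + y) = \<chi> x * \<chi> y" and "z \<in> G" "\<chi> z \<noteq> 1"
  shows "sum \<chi> G = 0"
proof -
  have neg: "- x \<in> G" if "x \<in> G" for x
    using assms(2)[OF that that] assms(2)[of 0 x] that by simp
  have "sum \<chi> G = (\<Sum>x\<in>G. \<chi> (x + z))"
    using assms(2)[OF _ assms(4)] assms(2)[OF _ neg[OF assms(4)]]
    by (intro sum.reindex_bij_witness[where i = "\<lambda>x. x + z" and j = "\<lambda>x. x - z"]) auto
  also have "\<dots> = sum \<chi> G * \<chi> z"
    by (simp add: assms(3) sum_distrib_right)
  finally show ?thesis using assms(5) by simp
qed

locale additive_character =
  fixes \<psi> :: "'a::{finite,field} \<Rightarrow> complex"
  assumes psi_0: "\<psi> 0 = 1" and psi_add: "\<psi> (x + y) = \<psi> x * \<psi> y"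
    and psi_nontrivial: "\<exists>x. \<psi> x \<noteq> 1"
begin

text \<open>For monic \<open>Q\<close> this is \<open>F \<mapsto> e(aF/Q)\<close>: the coefficient of \<open>1/T\<close> in the expansion of \<open>aF/Q\<close> at infinity is
  read off as the coefficient of degree \<open>degree Q - 1\<close> of the residue of \<open>aF\<close>.\<close>

definition chi :: "'a poly \<Rightarrow> 'a poly \<Rightarrow> 'a poly \<Rightarrow> complex" where
  "chi Q a F = \<psi> (coeff ((a * F) mod Q) (degree Q - 1))"

lemma chi_add_left: "chi Q (a + b) F = chi Q a F * chi Q b F"
  by (simp add: chi_def algebra_simps poly_mod_add_left psi_add)

lemma chi_add_right: "chi Q a (F + G) = chi Q a F * chi Q a G"
  by (simp add: chi_def algebra_simps poly_mod_add_left psi_add)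

lemma chi_commute: "chi Q a F = chi Q F a"
  by (simp add: chi_def mult.commute)

lemma chi_dvd: "Q dvd a * F \<Longrightarrow> chi Q a F = 1"
  by (simp add: chi_def psi_0 dvd_imp_mod_0)

lemma chi_mult_mod: "chi Q ((a * E) mod Q) F = chi Q a (E * F)"
  by (simp add: chi_def mod_mult_left_eq mult.assoc)

lemma psi_mult_nontrivial:
  assumes "c \<noteq> 0"
  shows "\<exists>x. \<psi> (c * x) \<noteq> 1"
proof -
  obtain y where "\<psi> y \<noteq> 1" using psi_nontrivial by blast
  then show ?thesis using assms by (intro exI[of _ "y / c"]) simp
qed

text \<open>The monomial lifts \<open>F\<close> to degree exactly \<open>degree Q - 1\<close>, so no
  reduction modulo \<open>Q\<close> takes place and the character reads off the leading coefficient
  of \<open>F\<close> times \<open>c\<close>.\<close>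

lemma chi_nontrivial_monom:
  assumes "F \<noteq> 0" "degree F < degree Q"
  shows "\<exists>c. chi Q (monom c (degree Q - 1 - degree F)) F \<noteq> 1"
proof -
  obtain c where c: "\<psi> (lead_coeff F * c) \<noteq> 1"
    using psi_mult_nontrivial[of "lead_coeff F"] assms by auto
  then have "c \<noteq> 0" using psi_0 by auto
  define a where "a = monom c (degree Q - 1 - degree F)"
  have a: "a \<noteq> 0" "degree a = degree Q - 1 - degree F" "lead_coeff a = c"
    using \<open>c \<noteq> 0\<close> by (auto simp: a_def degree_monom_eq)
  have deg: "degree (a * F) = degree Q - 1"
    using assms a by (simp add: degree_mult_eq)
  then have "a * F mod Q = a * F"
    using assms by (intro mod_poly_less) simp
  then have "chi Q a F = \<psi> (lead_coeff (a * F))"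
    by (simp only: chi_def deg)
  also have "\<dots> = \<psi> (lead_coeff F * c)"
    using a by (simp add: lead_coeff_mult mult.commute)
  finally show ?thesis using c a_def by metis
qed

lemma chi_nontrivial:
  assumes "Q \<noteq> 0" "\<not> Q dvd F"
  shows "\<exists>a\<in>lowdeg (degree Q). chi Q a F \<noteq> 1"
proof -
  have F: "F mod Q \<noteq> 0" "degree (F mod Q) < degree Q"
    using assms degree_mod_less'[of Q F] by (auto simp: mod_eq_0_iff_dvd)
  have "chi Q a (F mod Q) = chi Q a F" for a
    by (simp add: chi_def mod_mult_right_eq)
  then obtain c where "chi Q (monom c (degree Q - 1 - degree (F mod Q))) F \<noteq> 1"
    using chi_nontrivial_monom[OF F] by auto
  moreover have "monom c (degree Q - 1 - degree (F mod Q)) \<in> lowdeg (degree Q)"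
    using F by (auto simp: lowdeg_def)
  ultimately show ?thesis by blast
qed

text \<open>Orthogonality over the frequencies a/Q whose reduced denominator divides
  \<open>D\<close>. If \<open>D\<close> does not divide \<open>F\<close>, a frequency that detects
  \<open>E * F\<close> becomes, after multiplication by \<open>E\<close>, a member of this group
  that detects \<open>F\<close>.\<close>

lemma sum_chi_multiples:
  assumes Q: "Q = D * E" "Q \<noteq> 0"
  shows "(\<Sum>a | a \<in> lowdeg (degree Q) \<and> E dvd a. chi Q a F)
    = (if D dvd F then of_nat (CARD('a) ^ degree D) else 0)"
proof (cases "D dvd F")
  case True
  then have "(\<Sum>a | a \<in> lowdeg (degree Q) \<and> E dvd a. chi Q a F)
      = (\<Sum>a | a \<in> lowdeg (degree Q) \<and> E dvd a. 1)"
    by (intro sum.cong chi_dvd) (auto simp: Q(1) mult_dvd_mono mult.commute[of D])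
  moreover have "degree Q - degree E = degree D" "E \<noteq> 0"
    using Q by (auto simp: degree_mult_eq)
  ultimately show ?thesis using True card_multiples_lowdeg[of E "degree Q"] by simp
next
  case False
  then have "\<not> Q dvd E * F" using Q by (simp add: mult.commute[of D])
  from chi_nontrivial[OF Q(2) this] obtain a where a: "chi Q a (E * F) \<noteq> 1" by blast
  define b where "b = (a * E) mod Q"
  have "E dvd b" unfolding b_def using Q(1) by (intro dvd_mod) auto
  moreover have "b \<in> lowdeg (degree Q)"
    unfolding b_def lowdeg_iff by (rule degree_mod_less[OF Q(2)])
  moreover have "chi Q b F \<noteq> 1" unfolding b_def chi_mult_mod by (rule a)
  moreover have "finite {a \<in> lowdeg (degree Q). E dvd a}" by simp
  ultimately have "(\<Sum>a\<in>{a \<in> lowdeg (degree Q). E dvd a}. chi Q a F) = 0"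
    by (intro sum_nontrivial_character[where z = b]) (auto simp: chi_add_left)
  then show ?thesis using False by simp
qed

lemma sum_chi_lowdeg_full:
  assumes "Q \<noteq> 0"
  shows "(\<Sum>F\<in>lowdeg (degree Q). chi Q a F) = (if Q dvd a then of_nat (CARD('a) ^ degree Q) else 0)"
  using sum_chi_multiples[of Q Q 1 a] assms by (simp add: chi_commute[of Q a])

text \<open>The kernel of the short interval is an exact indicator. Inside the range, the product of
  \<open>a\<close> and \<open>v\<close> has degree below \<open>degree Q - 1\<close> and its
  coefficient there vanishes; outside, the monomial witness for \<open>a\<close> has degree below
  \<open>h\<close>.\<close>

lemma sum_chi_lowdeg:
  assumes "a \<in> lowdeg (degree Q)"
  shows "(\<Sum>v\<in>lowdeg h. chi Q a v)
    = (if a \<in> lowdeg (degree Q - h) then of_nat (CARD('a) ^ h) else 0)"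
proof (cases "a \<in> lowdeg (degree Q - h)")
  case True
  have "chi Q a v = 1" if v: "v \<in> lowdeg h" for v
  proof (cases "a = 0 \<or> v = 0")
    case True
    then show ?thesis by (auto intro: chi_dvd)
  next
    case False
    then have "degree (a * v) < degree Q - 1"
      using \<open>a \<in> lowdeg (degree Q - h)\<close> v by (auto simp: lowdeg_iff degree_mult_eq)
    then have "coeff (a * v mod Q) (degree Q - 1) = 0"
      by (subst mod_poly_less) (auto intro: coeff_eq_0)
    then show ?thesis by (simp add: chi_def psi_0)
  qed
  then show ?thesis using True by (simp add: card_lowdeg)
next
  case False
  then have a: "a \<noteq> 0" "degree a < degree Q" "degree Q - h \<le> degree a"
    using assms by (auto simp: lowdeg_iff)
  obtain c where c: "chi Q (monom c (degree Q - 1 - degree a)) a \<noteq> 1"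
    using chi_nontrivial_monom[OF a(1,2)] by blast
  have "monom c (degree Q - 1 - degree a) \<in> lowdeg h"
    using a by (auto simp: lowdeg_def)
  then have "(\<Sum>v\<in>lowdeg h. chi Q a v) = 0"
    using c by (intro sum_nontrivial_character[where z = "monom c (degree Q - 1 - degree a)"])
      (auto simp: chi_add_right chi_commute[of Q a])
  then show ?thesis using False by simp
qed

end

section \<open>Fourier expansion of the fifth moment\<close>

lemma CARD_field_ge_2: "CARD('a::{finite,field}) \<ge> 2"
  using card_mono[of "UNIV :: 'a set" "{0, 1}"] by simp

lemma poly_abs_less_iff: "poly_abs (F :: 'a::{finite,field} poly) < CARD('a) ^ t \<longleftrightarrow> F \<in> lowdeg t"
  using CARD_field_ge_2[where 'a='a] by (auto simp: poly_abs_def lowdeg_iff)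

lemma residues_mod_eq_lowdeg:
  "Q \<noteq> 0 \<Longrightarrow> residues_mod Q = lowdeg (degree Q)"
  unfolding residues_mod_def by (auto simp: poly_abs_less_iff[symmetric] poly_abs_def[of Q])

lemma short_interval_eq_image: "short_interval F h = (\<lambda>v. F + v) ` lowdeg h"
proof -
  have "G \<in> short_interval F h \<longleftrightarrow> G - F \<in> lowdeg h" for G
    using lowdeg_uminus[of "G - F" h] by (simp add: short_interval_def poly_abs_less_iff)
  moreover have "G \<in> (\<lambda>v. F + v) ` lowdeg h \<longleftrightarrow> G - F \<in> lowdeg h" for G
    by (metis (no_types, lifting) add.commute add_diff_cancel_left' diff_add_cancel image_iff)
  ultimately show ?thesis by blast
qed

definition pnorm :: "'a::{finite,field} poly \<Rightarrow> real" where
  "pnorm p = real CARD('a) ^ degree p"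

text \<open>Euler's function of the product when \<open>X\<close> consists of distinct monic
  irreducibles.\<close>

definition totient_prod :: "'a::{finite,field} poly set \<Rightarrow> real" where
  "totient_prod X = (\<Prod>p\<in>X. pnorm p - 1)"

text \<open>Distinct monic irreducibles are never associates, so the subsets of \<open>S\<close>
  correspond exactly to the monic divisors of \<open>Q\<close>.\<close>

locale prime_poly_set =
  fixes S :: "'a::{finite,field} poly set"
  assumes finite_S [simp]: "finite S"
    and irreducible_S: "p \<in> S \<Longrightarrow> irreducible p"
    and monic_S: "p \<in> S \<Longrightarrow> lead_coeff p = 1"
begin

abbreviation Q where "Q \<equiv> \<Prod>S"

text \<open>The density phi(Q)/|Q|, see \<open>poly_phi_Q\<close>; its inverse is the ratio in which
  the final bound is expressed.\<close>

definition rho :: real where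
  "rho = (\<Prod>p\<in>S. 1 - 1 / pnorm p)"

text \<open>The prime factors of the reduced denominator of \<open>a/Q\<close>.\<close>

definition supp :: "'a poly \<Rightarrow> 'a poly set" where
  "supp a = {p \<in> S. \<not> p dvd a}"

text \<open>For \<open>a \<noteq> 0\<close>, \<open>rho * wt 1 a\<close> is the modulus of the
  Fourier coefficient at \<open>a\<close>. Larger \<open>j\<close> absorb the number of ways to
  distribute the primes of a denominator over two summands. The value 0 at \<open>a = 0\<close>
  reflects the subtracted mean.\<close>

definition wt :: "nat \<Rightarrow> 'a poly \<Rightarrow> real" where
  "wt j a = (if a = 0 then 0 else real j ^ card (supp a) / totient_prod (supp a))"

lemma finite_subset_S [simp]: "X \<subseteq> S \<Longrightarrow> finite X"
  using finite_subset finite_S by blast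

lemma supp_subset [simp]: "supp a \<subseteq> S"
  by (auto simp: supp_def)

lemma finite_supp [simp]: "finite (supp a)"
  by simp

lemma supp_uminus [simp]: "supp (- a) = supp a"
  by (simp add: supp_def)

lemma wt_0 [simp]: "wt j 0 = 0"
  by (simp add: wt_def)

lemma wt_uminus [simp]: "wt j (- a) = wt j a"
  by (simp add: wt_def)

lemma prime_S: "p \<in> S \<Longrightarrow> prime_elem p"
  by (intro field_poly_irreducible_imp_prime irreducible_S)

lemma S_nonzero: "p \<in> S \<Longrightarrow> p \<noteq> 0"
  using irreducible_S by (metis not_irreducible_zero)

lemma degree_S: "p \<in> S \<Longrightarrow> degree p > 0"
  using irreducible_S[of p] S_nonzero[of p] is_unit_iff_degree[of p] by (auto simp: irreducible_def)

lemma pnorm_ge_2: "p \<in> S \<Longrightarrow> pnorm p \<ge> 2"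
proof -
  assume "p \<in> S"
  have "(2::real) \<le> real CARD('a) ^ 1"
    using CARD_field_ge_2[where 'a='a] by simp
  also have "\<dots> \<le> real CARD('a) ^ degree p"
    using CARD_field_ge_2[where 'a='a] degree_S[OF \<open>p \<in> S\<close>] by (intro power_increasing) auto
  finally show "pnorm p \<ge> 2" by (simp add: pnorm_def)
qed

lemma pnorm_pos: "p \<in> S \<Longrightarrow> pnorm p > 0"
  using pnorm_ge_2 by force

lemma pnorm_gt_1: "p \<in> S \<Longrightarrow> pnorm p > 1"
  using pnorm_ge_2 by force

lemma dvd_S_imp_eq:
  assumes "p \<in> S" "p' \<in> S" "p dvd p'"
  shows "p = p'"
proof -
  obtain u where u: "p' = p * u" using assms(3) by (rule dvdE)
  have "is_unit u"
    using irreducibleD[OF irreducible_S[OF assms(2)] u] irreducible_S[OF assms(1)]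
    by (auto simp: irreducible_def)
  moreover have "u \<noteq> 0" using u S_nonzero[OF assms(2)] by auto
  ultimately obtain c where c: "u = [:c:]" "c \<noteq> 0"
    by (metis is_unit_iff_degree degree_eq_zeroE pCons_0_0)
  then have "c = 1"
    using u monic_S[OF assms(1)] monic_S[OF assms(2)] by (simp add: lead_coeff_mult)
  then show ?thesis using u c by (simp add: one_pCons[symmetric])
qed

lemma prime_dvd_prod_S_iff:
  assumes "p \<in> S" "X \<subseteq> S"
  shows "p dvd \<Prod>X \<longleftrightarrow> p \<in> X"
proof -
  have "finite X" using assms by simp
  then have "p dvd \<Prod>X \<longleftrightarrow> (\<exists>p'\<in>X. p dvd p')"
    using prime_elem_dvd_mult_iff[OF prime_S[OF assms(1)]] prime_elem_not_unit[OF prime_S[OF assms(1)]]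
    by (induction X) auto
  then show ?thesis
    using assms(2) dvd_S_imp_eq[OF assms(1)] by (metis dvd_refl subsetD)
qed

lemma prod_S_dvd_iff:
  assumes "X \<subseteq> S"
  shows "\<Prod>X dvd F \<longleftrightarrow> (\<forall>p\<in>X. p dvd F)"
proof
  assume "\<Prod>X dvd F"
  then show "\<forall>p\<in>X. p dvd F"
    using assms by (meson dvd_prodI dvd_trans finite_subset_S)
next
  have "finite X" using assms by simp
  moreover assume "\<forall>p\<in>X. p dvd F"
  ultimately show "\<Prod>X dvd F" using assms
  proof (induction X)
    case (insert p X)
    then obtain k where k: "F = \<Prod>X * k" by (auto elim: dvdE)
    have "p dvd \<Prod>X * k" using insert k by simp
    then have "p dvd k"
      using insert prime_S prime_dvd_prod_S_iff[of p X] by (auto simp: prime_elem_dvd_mult_iff)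
    then show ?case using insert k by (simp add: mult.commute mult_dvd_mono)
  qed simp
qed

lemma prod_S_nonzero [simp]: "X \<subseteq> S \<Longrightarrow> \<Prod>X \<noteq> 0"
  using S_nonzero[of 0] by auto

lemma Q_nonzero [simp]: "Q \<noteq> 0"
  by (rule prod_S_nonzero) simp

lemma Q_dvd_lowdeg_iff: "a \<in> lowdeg (degree Q) \<Longrightarrow> Q dvd a \<longleftrightarrow> a = 0"
  using dvd_imp_degree_le[of Q a] by (cases "a = 0") (auto simp: lowdeg_iff)

lemma prod_S_split: "X \<subseteq> Y \<Longrightarrow> Y \<subseteq> S \<Longrightarrow> \<Prod>Y = \<Prod>(Y - X) * \<Prod>X"
  by (rule prod.subset_diff) auto

lemma prod_S_union: "X \<subseteq> S \<Longrightarrow> Y \<subseteq> S \<Longrightarrow> X \<inter> Y = {} \<Longrightarrow> \<Prod>(X \<union> Y) = \<Prod>X * \<Prod>Y"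
  by (rule prod.union_disjoint) auto

lemma prod_pnorm:
  assumes "X \<subseteq> S"
  shows "(\<Prod>p\<in>X. pnorm p) = real CARD('a) ^ degree (\<Prod>X)"
proof -
  have "finite X" using assms by simp
  then show ?thesis using assms
  proof (induction X)
    case (insert p X)
    then have "degree (p * \<Prod>X) = degree p + degree (\<Prod>X)"
      by (intro degree_mult_eq prod_S_nonzero S_nonzero) auto
    with insert show ?case
      by (simp add: pnorm_def power_add)
  qed simp
qed

lemma coprime_Q_iff: "coprime F Q \<longleftrightarrow> (\<forall>p\<in>S. \<not> p dvd F)"
proof
  assume "coprime F Q"
  show "\<forall>p\<in>S. \<not> p dvd F"
  proof (intro ballI notI)
    fix p assume "p \<in> S" "p dvd F"
    moreover have "p dvd Q" using \<open>p \<in> S\<close> by (simp add: prime_dvd_prod_S_iff)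
    ultimately have "is_unit p" using \<open>coprime F Q\<close> coprime_common_divisor by blast
    then show False using irreducible_S[OF \<open>p \<in> S\<close>] by (simp add: irreducible_def)
  qed
next
  assume "\<forall>p\<in>S. \<not> p dvd F"
  \<comment> \<open>The primes of \<open>X\<close> that do not divide \<open>c\<close> are stripped
    one by one from the product that \<open>c\<close> divides.\<close>
  moreover have "is_unit c" if "X \<subseteq> S" "c dvd \<Prod>X" "\<And>p. p \<in> X \<Longrightarrow> \<not> p dvd c" for c X
  proof -
    have "finite X" using that(1) by simp
    then show ?thesis using that
    proof (induction X)
      case (insert p X)
      obtain k where k: "p * \<Prod>X = c * k" using insert by (auto simp: dvd_def)
      then have "p dvd c * k" by (metis dvd_triv_left)
      then have "p dvd k" using insert prime_S[of p] by (auto simp: prime_elem_dvd_mult_iff)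
      then obtain k' where "k = p * k'" by (rule dvdE)
      with k have "\<Prod>X = c * k'" using insert S_nonzero[of p] by auto
      with insert show ?case by auto
    qed simp
  qed
  ultimately show "coprime F Q"
    by (intro coprimeI) (meson dvd_trans order_refl)
qed

lemma totient_prod_pos: "X \<subseteq> S \<Longrightarrow> totient_prod X > 0"
  unfolding totient_prod_def using pnorm_ge_2 by (intro prod_pos) force

lemma rho_pos: "rho > 0"
  unfolding rho_def using pnorm_ge_2 by (intro prod_pos) (force simp: field_simps)

lemma rho_le_1: "rho \<le> 1"
  unfolding rho_def using pnorm_ge_2 by (intro prod_le_1) (force simp: field_simps)

lemma wt_nonneg [simp]: "wt j a \<ge> 0"
  using totient_prod_pos[of "supp a"] by (auto simp: wt_def)

text \<open>Inclusion-exclusion over the divisors of \<open>Q\<close>: the divisor with prime set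
  \<open>Y\<close> carries its Moebius sign, and its divisibility indicator is the average over the
  frequencies with denominator dividing it, that is, \<open>supp a \<subseteq> Y\<close>.\<close>

definition fourier_coeff :: "'a poly \<Rightarrow> real" where
  "fourier_coeff a =
    (\<Sum>Y\<in>Pow S. if supp a \<subseteq> Y then (-1) ^ card Y / (\<Prod>p\<in>Y. pnorm p) else 0)"

text \<open>Writing \<open>Y\<close> as \<open>supp a\<close> together with a free subset
  \<open>Z\<close> of the other primes turns the sum over \<open>Z\<close> into an Euler
  product.\<close>

lemma fourier_coeff_eq:
  "fourier_coeff a = (-1) ^ card (supp a) / (\<Prod>p\<in>supp a. pnorm p) * (\<Prod>p\<in>S - supp a. 1 - 1 / pnorm p)"
proof -
  let ?X = "supp a"
  have "fourier_coeff a = (\<Sum>Y | Y \<in> Pow S \<and> ?X \<subseteq> Y. (-1) ^ card Y / (\<Prod>p\<in>Y. pnorm p))"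
    unfolding fourier_coeff_def by (subst sum.inter_filter[symmetric]) auto
  also have "\<dots> = (\<Sum>Z\<in>Pow (S - ?X). (-1) ^ card (?X \<union> Z) / (\<Prod>p\<in>?X \<union> Z. pnorm p))"
    using supp_subset[of a]
    by (intro sum.reindex_bij_witness[where i = "\<lambda>Z. ?X \<union> Z" and j = "\<lambda>Y. Y - ?X"])
      (auto simp: Un_absorb1 Un_absorb2)
  also have "\<dots> = (\<Sum>Z\<in>Pow (S - ?X). (-1) ^ card ?X / (\<Prod>p\<in>?X. pnorm p) *
      ((-1) ^ card Z * (\<Prod>p\<in>Z. 1 / pnorm p) * (\<Prod>p\<in>S - ?X - Z. 1)))"
  proof (intro sum.cong refl)
    fix Z assume Z: "Z \<in> Pow (S - ?X)"
    then have "finite Z" "?X \<inter> Z = {}" by (auto intro: finite_subset[OF _ finite_S])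
    then show "(-1) ^ card (?X \<union> Z) / (\<Prod>p\<in>?X \<union> Z. pnorm p) = (-1) ^ card ?X / (\<Prod>p\<in>?X. pnorm p) *
      ((-1) ^ card Z * (\<Prod>p\<in>Z. 1 / pnorm p) * (\<Prod>p\<in>S - ?X - Z. 1))"
      by (simp add: card_Un_disjoint prod.union_disjoint power_add prod_dividef)
  qed
  also have "\<dots> = (-1) ^ card ?X / (\<Prod>p\<in>?X. pnorm p) * (\<Prod>p\<in>S - ?X. 1 - 1 / pnorm p)"
    unfolding sum_distrib_left[symmetric] by (subst prod_diff_conv_sum) auto
  finally show ?thesis .
qed

text \<open>The Euler product over the primes outside \<open>supp a\<close> is \<open>rho\<close>
  divided by the factors inside, and these turn the norm of the denominator into its
  totient.\<close>

lemma abs_fourier_coeff: "\<bar>fourier_coeff a\<bar> = rho / totient_prod (supp a)"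
proof -
  let ?X = "supp a"
  have pos: "(\<Prod>p\<in>?X. pnorm p) > 0" "(\<Prod>p\<in>S - ?X. 1 - 1 / pnorm p) > 0"
    using pnorm_pos pnorm_gt_1 subsetD[OF supp_subset[of a]] by (auto intro!: prod_pos)
  have "(\<Prod>p\<in>?X. 1 - 1 / pnorm p) * (\<Prod>p\<in>?X. pnorm p) = totient_prod ?X"
    unfolding totient_prod_def prod.distrib[symmetric]
    using pnorm_pos subsetD[OF supp_subset[of a]]
    by (intro prod.cong refl) (simp add: left_diff_distrib less_imp_neq[symmetric])
  moreover have "rho = (\<Prod>p\<in>S - ?X. 1 - 1 / pnorm p) * (\<Prod>p\<in>?X. 1 - 1 / pnorm p)"
    unfolding rho_def by (rule prod.subset_diff) auto
  ultimately have "rho * (\<Prod>p\<in>?X. pnorm p) = (\<Prod>p\<in>S - ?X. 1 - 1 / pnorm p) * totient_prod ?X"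
    by (simp add: mult.assoc)
  then have "(\<Prod>p\<in>S - ?X. 1 - 1 / pnorm p) / (\<Prod>p\<in>?X. pnorm p) = rho / totient_prod ?X"
    using pos totient_prod_pos[of ?X] by (metis frac_eq_eq less_irrefl supp_subset)
  then show ?thesis
    using pos by (simp add: fourier_coeff_eq abs_mult power_abs abs_divide)
qed

lemma fourier_coeff_0: "fourier_coeff 0 = rho"
  by (simp add: fourier_coeff_eq rho_def supp_def)

text \<open>The weighted number of representations of \<open>b\<close> as a sum of two frequencies;
  for \<open>b\<close> in the same range the second summand \<open>b - a\<close> stays in it
  automatically.\<close>

definition conv :: "nat \<Rightarrow> ('a poly \<Rightarrow> real) \<Rightarrow> 'a poly \<Rightarrow> real" where
  "conv h u b = (\<Sum>a\<in>lowdeg (degree Q - h). u a * u (b - a))"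

end

section \<open>From the coprimality indicator to a sum over five frequencies\<close>

locale prime_poly_set_character = prime_poly_set S + additive_character \<psi>
  for S :: "'a::{finite,field} poly set" and \<psi> :: "'a \<Rightarrow> complex"
begin

lemma coprime_Q_expansion:
  "of_bool (coprime F Q) = (\<Sum>a\<in>lowdeg (degree Q). of_real (fourier_coeff a) * chi Q a F)"
proof -
  \<comment> \<open>The frequencies with denominator dividing the product over \<open>Y\<close> are
    the multiples of the complementary product over \<open>S - Y\<close>.\<close>
  have dvd_sum: "of_bool (\<Prod>Y dvd F) = (\<Sum>a\<in>lowdeg (degree Q). if supp a \<subseteq> Y
      then chi Q a F / (\<Prod>p\<in>Y. of_real (pnorm p)) else 0)" if Y: "Y \<subseteq> S" for Y
  proof -
    have "Q = \<Prod>Y * \<Prod>(S - Y)"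
      using prod_S_split[OF Y] by (simp add: mult.commute)
    note s = sum_chi_multiples[OF this Q_nonzero, of F]
    have "\<Prod>(S - Y) dvd a \<longleftrightarrow> supp a \<subseteq> Y" for a
      by (subst prod_S_dvd_iff) (auto simp: supp_def)
    with s have "(\<Sum>a | a \<in> lowdeg (degree Q) \<and> supp a \<subseteq> Y. chi Q a F)
        = (if \<Prod>Y dvd F then of_nat (CARD('a) ^ degree (\<Prod>Y)) else 0)"
      by simp
    moreover have "(\<Prod>p\<in>Y. of_real (pnorm p)) = (of_nat (CARD('a) ^ degree (\<Prod>Y)) :: complex)"
      using prod_pnorm[OF Y] by (simp flip: of_real_prod)
    ultimately have "of_bool (\<Prod>Y dvd F) = (\<Sum>a | a \<in> lowdeg (degree Q) \<and> supp a \<subseteq> Y. chi Q a F)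
         / (\<Prod>p\<in>Y. of_real (pnorm p))"
      by simp
    also have "\<dots> = (\<Sum>a\<in>lowdeg (degree Q). if supp a \<subseteq> Y
      then chi Q a F / (\<Prod>p\<in>Y. of_real (pnorm p)) else 0)"
      unfolding sum_divide_distrib by (rule sum.inter_filter) simp
    finally show ?thesis .
  qed
  have "(of_bool (coprime F Q) :: complex) = (\<Prod>p\<in>S. 1 - of_bool (p dvd F))"
    unfolding coprime_Q_iff by (cases "\<forall>p\<in>S. \<not> p dvd F") (auto intro!: prod_zero[symmetric])
  also have "\<dots> = (\<Sum>Y\<in>Pow S. (-1) ^ card Y * (\<Prod>p\<in>Y. of_bool (p dvd F)))"
    by (subst prod_diff_conv_sum) auto
  also have "\<dots> = (\<Sum>Y\<in>Pow S. (-1) ^ card Y * of_bool (\<Prod>Y dvd F))"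
  proof (intro sum.cong refl arg_cong2[where f = "(*)"])
    fix Y assume "Y \<in> Pow S"
    then show "(\<Prod>p\<in>Y. of_bool (p dvd F)) = (of_bool (\<Prod>Y dvd F) :: complex)"
      by (cases "\<forall>p\<in>Y. p dvd F") (auto simp: prod_S_dvd_iff intro!: prod_zero)
  qed
  also have "\<dots> = (\<Sum>Y\<in>Pow S. \<Sum>a\<in>lowdeg (degree Q). (-1) ^ card Y * (if supp a \<subseteq> Y
      then chi Q a F / (\<Prod>p\<in>Y. of_real (pnorm p)) else 0))"
    by (intro sum.cong refl, subst dvd_sum) (auto simp: sum_distrib_left)
  also have "\<dots> = (\<Sum>a\<in>lowdeg (degree Q). of_real (fourier_coeff a) * chi Q a F)"
    unfolding fourier_coeff_def
    by (subst sum.swap) (auto simp: sum_distrib_right intro!: sum.cong)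
  finally show ?thesis .
qed

lemma poly_phi_Q: "real (poly_phi Q) = real CARD('a) ^ degree Q * rho"
proof -
  have "(of_nat (poly_phi Q) :: complex) = (\<Sum>F\<in>lowdeg (degree Q). of_bool (coprime F Q))"
    by (simp add: poly_phi_def residues_mod_eq_lowdeg sum.If_cases of_bool_def Int_def)
  also have "\<dots> = (\<Sum>a\<in>lowdeg (degree Q). of_real (fourier_coeff a) * (\<Sum>F\<in>lowdeg (degree Q). chi Q a F))"
    unfolding coprime_Q_expansion by (subst sum.swap) (simp add: sum_distrib_left)
  also have "\<dots> = (\<Sum>a\<in>lowdeg (degree Q). if a = (0 :: 'a poly) then of_real (fourier_coeff 0 * real CARD('a) ^ degree Q) else 0)"
  proof (intro sum.cong refl)
    fix a :: "'a poly" assume "a \<in> lowdeg (degree Q)"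
    from Q_dvd_lowdeg_iff[OF this] show "of_real (fourier_coeff a) * (\<Sum>F\<in>lowdeg (degree Q). chi Q a F) =
        (if a = 0 then of_real (fourier_coeff 0 * real CARD('a) ^ degree Q) else 0)"
      using sum_chi_lowdeg_full[OF Q_nonzero, of a] by auto
  qed
  also have "\<dots> = of_real (rho * real CARD('a) ^ degree Q)"
    by (simp add: fourier_coeff_0)
  finally show ?thesis
    by (metis mult.commute of_real_eq_iff of_real_of_nat_eq)
qed

lemma poly_abs_Q: "poly_abs Q = CARD('a) ^ degree Q"
  by (simp add: poly_abs_def)

definition nonconst_coeff :: "'a poly \<Rightarrow> real" where
  "nonconst_coeff a = (if a = 0 then 0 else fourier_coeff a)"

text \<open>Summing over the interval kills all frequencies outside
  \<open>lowdeg (degree Q - h)\<close>. The zero frequency contributes exactly the subtracted mean,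
  hence \<open>nonconst_coeff\<close>.\<close>

lemma deviation_expansion:
  "of_real (real (card {G \<in> short_interval F h. coprime G Q})
      - real (CARD('a) ^ h) * real (poly_phi Q) / real (poly_abs Q))
    = of_nat (CARD('a) ^ h) * (\<Sum>a\<in>lowdeg (degree Q - h). of_real (nonconst_coeff a) * chi Q a F)"
proof -
  let ?V = "lowdeg (degree Q - h) :: 'a poly set"
  have "{G \<in> short_interval F h. coprime G Q} = (\<lambda>v. F + v) ` {v \<in> lowdeg h. coprime (F + v) Q}"
    by (auto simp: short_interval_eq_image)
  then have "card {G \<in> short_interval F h. coprime G Q} = card {v \<in> lowdeg h. coprime (F + v) Q}"
    by (simp add: card_image)
  then have "(of_nat (card {G \<in> short_interval F h. coprime G Q}) :: complex)
      = (\<Sum>v\<in>lowdeg h. of_bool (coprime (F + v) Q))"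
    by (simp add: sum.If_cases of_bool_def Int_def)
  also have "\<dots> = (\<Sum>a\<in>lowdeg (degree Q). of_real (fourier_coeff a) * chi Q a F * (\<Sum>v\<in>lowdeg h. chi Q a v))"
    unfolding coprime_Q_expansion
    by (subst sum.swap) (simp add: sum_distrib_left chi_add_right mult.assoc)
  also have "\<dots> = (\<Sum>a\<in>lowdeg (degree Q). if a \<in> ?V
       then of_nat (CARD('a) ^ h) * (of_real (fourier_coeff a) * chi Q a F) else 0)"
    by (intro sum.cong refl, subst sum_chi_lowdeg) auto
  also have "\<dots> = (\<Sum>a\<in>?V. of_nat (CARD('a) ^ h) * (of_real (fourier_coeff a) * chi Q a F))"
    using lowdeg_mono[of "degree Q - h" "degree Q"]
    by (intro sum.mono_neutral_cong_right) auto
  also have "\<dots> = of_nat (CARD('a) ^ h) * (\<Sum>a\<in>?V. of_real (fourier_coeff a) * chi Q a F)"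
    by (simp add: sum_distrib_left)
  also have "(\<Sum>a\<in>?V. of_real (fourier_coeff a) * chi Q a F)
      = of_real rho + (\<Sum>a\<in>?V - {0}. of_real (fourier_coeff a) * chi Q a F)"
    by (subst sum.remove[of _ 0]) (auto simp: fourier_coeff_0 chi_dvd)
  also have "(\<Sum>a\<in>?V - {0}. of_real (fourier_coeff a) * chi Q a F) = (\<Sum>a\<in>?V. of_real (nonconst_coeff a) * chi Q a F)"
    by (intro sum.mono_neutral_cong_left) (auto simp: nonconst_coeff_def)
  finally have "(of_nat (card {G \<in> short_interval F h. coprime G Q}) :: complex)
     = of_nat (CARD('a) ^ h) * (of_real rho + (\<Sum>a\<in>?V. of_real (nonconst_coeff a) * chi Q a F))" .
  moreover have "real (poly_phi Q) / real (poly_abs Q) = rho"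
    by (simp add: poly_phi_Q poly_abs_Q)
  then have "real (CARD('a) ^ h) * real (poly_phi Q) / real (poly_abs Q) = real (CARD('a) ^ h) * rho"
    by (metis times_divide_eq_right)
  ultimately show ?thesis
    by (simp add: algebra_simps)
qed

lemma square_expansion:
  fixes h :: nat
  defines "V \<equiv> lowdeg (degree Q - h)"
  shows "(\<Sum>a\<in>V. of_real (u a) * chi Q a F)\<^sup>2 = (\<Sum>b\<in>V. of_real (conv h u b) * chi Q b F)"
proof -
  have "(\<Sum>a\<in>V. of_real (u a) * chi Q a F)\<^sup>2
    = (\<Sum>a\<in>V. \<Sum>b\<in>V. (of_real (u a) * chi Q a F) * (of_real (u b) * chi Q b F))"
    by (simp add: power2_eq_square sum_product)
  also have "\<dots> = (\<Sum>a\<in>V. \<Sum>b\<in>V. of_real (u a * u (b - a)) * chi Q b F)"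
  proof (rule sum.cong[OF refl])
    fix a assume a: "a \<in> V"
    show "(\<Sum>b\<in>V. (of_real (u a) * chi Q a F) * (of_real (u b) * chi Q b F))
      = (\<Sum>b\<in>V. of_real (u a * u (b - a)) * chi Q b F)"
      using a unfolding V_def
      by (intro sum.reindex_bij_witness[where i = "\<lambda>b. b - a" and j = "\<lambda>b. b + a"])
        (auto simp: chi_add_left)
  qed
  also have "\<dots> = (\<Sum>b\<in>V. of_real (conv h u b) * chi Q b F)"
    by (subst sum.swap) (simp add: conv_def V_def sum_distrib_right)
  finally show ?thesis .
qed

text \<open>The fifth power is split as 2 + 2 + 1, the two squares becoming convolutions;
  orthogonality over \<open>F\<close> then forces the three frequencies to add up to zero.\<close>

lemma reduced_moment_5_eq:
  fixes h :: nat
  defines "V \<equiv> lowdeg (degree Q - h)"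
  shows "reduced_moment 5 Q h = real CARD('a) ^ degree Q * (real CARD('a) ^ h) ^ 5 *
    (\<Sum>b\<in>V. \<Sum>c\<in>V. conv h nonconst_coeff b * conv h nonconst_coeff c * nonconst_coeff (- (b + c)))"
proof -
  let ?N = "of_nat (CARD('a) ^ h) :: complex"
  let ?D = "\<lambda>F. \<Sum>a\<in>V. of_real (nonconst_coeff a) * chi Q a F"
  have sub: "V \<subseteq> lowdeg (degree Q)" unfolding V_def by (rule lowdeg_mono) simp
  have "of_real (reduced_moment 5 Q h) = (\<Sum>F\<in>lowdeg (degree Q). (?N * ?D F) ^ 5)"
    unfolding reduced_moment_def V_def
    by (simp only: of_real_sum of_real_power deviation_expansion residues_mod_eq_lowdeg[OF Q_nonzero])
  also have "\<dots> = ?N ^ 5 * (\<Sum>F\<in>lowdeg (degree Q). (?D F)\<^sup>2 * (?D F)\<^sup>2 * ?D F)"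
  proof -
    have "(x * y) ^ 5 = x ^ 5 * (y\<^sup>2 * y\<^sup>2 * y)" for x y :: complex
      by (simp add: eval_nat_numeral mult_ac)
    then show ?thesis by (simp only: sum_distrib_left[symmetric])
  qed
  also have "(\<Sum>F\<in>lowdeg (degree Q). (?D F)\<^sup>2 * (?D F)\<^sup>2 * ?D F)
    = (\<Sum>F\<in>lowdeg (degree Q). \<Sum>b\<in>V. \<Sum>c\<in>V. \<Sum>a\<in>V.
        of_real (conv h nonconst_coeff b * conv h nonconst_coeff c * nonconst_coeff a) * chi Q (a + (b + c)) F)"
  proof (rule sum.cong[OF refl])
    fix F
    have triple: "(\<Sum>b\<in>V. f b) * (\<Sum>c\<in>V. g c) * (\<Sum>a\<in>V. k a) = (\<Sum>b\<in>V. \<Sum>c\<in>V. \<Sum>a\<in>V. f b * g c * k a)"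
      for f g k :: "'a poly \<Rightarrow> complex"
      by (simp only: sum_distrib_left[symmetric] sum_distrib_right[symmetric])
    have term_eq: "(of_real x * chi Q b F) * (of_real y * chi Q c F) * (of_real z * chi Q a F)
      = of_real (x * y * z) * chi Q (a + (b + c)) F" for x y z a b c
      by (simp add: chi_add_left)
    show "(?D F)\<^sup>2 * (?D F)\<^sup>2 * ?D F = (\<Sum>b\<in>V. \<Sum>c\<in>V. \<Sum>a\<in>V.
        of_real (conv h nonconst_coeff b * conv h nonconst_coeff c * nonconst_coeff a) * chi Q (a + (b + c)) F)"
      unfolding V_def square_expansion unfolding V_def[symmetric] triple term_eq ..
  qed
  also have "\<dots> = (\<Sum>b\<in>V. \<Sum>c\<in>V. \<Sum>a\<in>V. of_real (conv h nonconst_coeff b * conv h nonconst_coeff c * nonconst_coeff a)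
        * (\<Sum>F\<in>lowdeg (degree Q). chi Q (a + (b + c)) F))"
    unfolding sum_distrib_left
    by (subst sum.swap, rule sum.cong[OF refl], subst sum.swap, rule sum.cong[OF refl],
        subst sum.swap, rule refl)
  also have "\<dots> = (\<Sum>b\<in>V. \<Sum>c\<in>V. \<Sum>a\<in>V. if a = - (b + c)
      then of_real (conv h nonconst_coeff b * conv h nonconst_coeff c * nonconst_coeff (- (b + c))) * of_nat (CARD('a) ^ degree Q) else 0)"
  proof (intro sum.cong refl)
    \<comment> \<open>The sum of the three still has degree below \<open>degree Q\<close>, so
      vanishing modulo \<open>Q\<close> means vanishing as a polynomial.\<close>
    fix a b c assume "b \<in> V" "c \<in> V" "a \<in> V"
    then have "a + (b + c) \<in> lowdeg (degree Q)" using sub by auto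
    from Q_dvd_lowdeg_iff[OF this] have "Q dvd a + (b + c) \<longleftrightarrow> a + (b + c) = 0" .
    also have "\<dots> \<longleftrightarrow> a = - (b + c)" by (rule eq_neg_iff_add_eq_0[symmetric])
    finally show "of_real (conv h nonconst_coeff b * conv h nonconst_coeff c * nonconst_coeff a)
        * (\<Sum>F\<in>lowdeg (degree Q). chi Q (a + (b + c)) F) = (if a = - (b + c)
      then of_real (conv h nonconst_coeff b * conv h nonconst_coeff c * nonconst_coeff (- (b + c))) * of_nat (CARD('a) ^ degree Q) else 0)"
      by (subst sum_chi_lowdeg_full) auto
  qed
  also have "\<dots> = (\<Sum>b\<in>V. \<Sum>c\<in>V. of_real (conv h nonconst_coeff b * conv h nonconst_coeff c * nonconst_coeff (- (b + c)))
      * of_nat (CARD('a) ^ degree Q))"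
  proof (intro sum.cong refl)
    fix b c assume "b \<in> V" "c \<in> V"
    then have "- (b + c) \<in> V" unfolding V_def lowdeg_uminus by auto
    then show "(\<Sum>a\<in>V. if a = - (b + c)
      then of_real (conv h nonconst_coeff b * conv h nonconst_coeff c * nonconst_coeff (- (b + c))) * of_nat (CARD('a) ^ degree Q) else 0) =
      (of_real (conv h nonconst_coeff b * conv h nonconst_coeff c * nonconst_coeff (- (b + c))) * of_nat (CARD('a) ^ degree Q) :: complex)"
      by (subst sum.delta) (auto simp: V_def)
  qed
  also have "?N ^ 5 * \<dots> = of_real (real CARD('a) ^ degree Q * (real CARD('a) ^ h) ^ 5 *
    (\<Sum>b\<in>V. \<Sum>c\<in>V. conv h nonconst_coeff b * conv h nonconst_coeff c * nonconst_coeff (- (b + c))))"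
  proof -
    have "?N ^ 5 * (of_real Z * of_nat (CARD('a) ^ degree Q))
      = of_real (real CARD('a) ^ degree Q * (real CARD('a) ^ h) ^ 5 * Z)" for Z
      by simp
    then show ?thesis by (simp only: sum_distrib_right[symmetric] of_real_sum[symmetric])
  qed
  finally show ?thesis unfolding of_real_eq_iff .
qed

lemma abs_nonconst_coeff: "\<bar>nonconst_coeff a\<bar> = rho * wt 1 a"
  by (simp add: nonconst_coeff_def wt_def abs_fourier_coeff)

lemma abs_conv_nonconst_coeff_le: "\<bar>conv h nonconst_coeff b\<bar> \<le> rho\<^sup>2 * conv h (wt 1) b"
proof -
  have "\<bar>conv h nonconst_coeff b\<bar> \<le> (\<Sum>a\<in>lowdeg (degree Q - h). \<bar>nonconst_coeff a * nonconst_coeff (b - a)\<bar>)"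
    unfolding conv_def by (rule sum_abs)
  also have "\<dots> = rho\<^sup>2 * conv h (wt 1) b"
    by (simp add: conv_def abs_mult abs_nonconst_coeff sum_distrib_left power2_eq_square mult_ac)
  finally show ?thesis .
qed

lemma conv_wt_nonneg [simp]: "conv h (wt j) b \<ge> 0"
  unfolding conv_def by (intro sum_nonneg) auto

lemma conv_wt_uminus: "conv h (wt j) (- b) = conv h (wt j) b"
proof -
  have "wt j (- b - a) = wt j (b + a)" for a
    using wt_uminus[of j "b + a"] by simp
  then show ?thesis
    unfolding conv_def by (intro sum.reindex_bij_witness[where i = uminus and j = uminus]) auto
qed

text \<open>All cancellation is given up here. Changing the sign of \<open>c\<close> puts the sum
  into the form with \<open>b - c\<close>, symmetric in \<open>b\<close> and
  \<open>c\<close>.\<close>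

lemma abs_reduced_moment_5_le:
  fixes h :: nat
  defines "V \<equiv> lowdeg (degree Q - h)"
  shows "\<bar>reduced_moment 5 Q h\<bar> \<le> real CARD('a) ^ degree Q * (real CARD('a) ^ h) ^ 5 * rho ^ 5 *
    (\<Sum>b\<in>V. \<Sum>c\<in>V. conv h (wt 1) b * conv h (wt 1) c * wt 1 (b - c))"
proof -
  have "\<bar>\<Sum>b\<in>V. \<Sum>c\<in>V. conv h nonconst_coeff b * conv h nonconst_coeff c * nonconst_coeff (- (b + c))\<bar>
    \<le> (\<Sum>b\<in>V. \<Sum>c\<in>V. \<bar>conv h nonconst_coeff b * conv h nonconst_coeff c * nonconst_coeff (- (b + c))\<bar>)"
    by (rule order.trans[OF sum_abs sum_mono[OF sum_abs]])
  also have "\<dots> \<le> (\<Sum>b\<in>V. \<Sum>c\<in>V. (rho\<^sup>2 * conv h (wt 1) b) * (rho\<^sup>2 * conv h (wt 1) c) * (rho * wt 1 (b + c)))"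
    unfolding abs_mult abs_nonconst_coeff wt_uminus
    using rho_pos by (intro sum_mono mult_mono abs_conv_nonconst_coeff_le) auto
  also have "\<dots> = rho ^ 5 * (\<Sum>b\<in>V. \<Sum>c\<in>V. conv h (wt 1) b * conv h (wt 1) c * wt 1 (b + c))"
  proof -
    have "(rho\<^sup>2 * x) * (rho\<^sup>2 * y) * (rho * z) = rho ^ 5 * (x * y * z)" for x y z
      by (simp add: eval_nat_numeral)
    then show ?thesis by (simp only: sum_distrib_left)
  qed
  also have "(\<Sum>b\<in>V. \<Sum>c\<in>V. conv h (wt 1) b * conv h (wt 1) c * wt 1 (b + c))
     = (\<Sum>b\<in>V. \<Sum>c\<in>V. conv h (wt 1) b * conv h (wt 1) c * wt 1 (b - c))"
    unfolding V_def
    by (rule sum.cong[OF refl], rule sum.reindex_bij_witness[where i = uminus and j = uminus])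
       (auto simp: conv_wt_uminus)
  finally have "\<bar>\<Sum>b\<in>V. \<Sum>c\<in>V. conv h nonconst_coeff b * conv h nonconst_coeff c * nonconst_coeff (- (b + c))\<bar>
    \<le> rho ^ 5 * (\<Sum>b\<in>V. \<Sum>c\<in>V. conv h (wt 1) b * conv h (wt 1) c * wt 1 (b - c))" .
  from mult_left_mono[OF this, of "real CARD('a) ^ degree Q * (real CARD('a) ^ h) ^ 5"]
  show ?thesis
    unfolding V_def reduced_moment_5_eq abs_mult by (simp only: mult.assoc) auto
qed

end

section \<open>Weights on the dual group\<close>

text \<open>The usual divisor bound: an element of degree at least \<open>t\<close> pays for its
  factor \<open>J\<close> by \<open>x ^ t\<close>, and there are boundedly many elements of smaller
  degree. This is the only source of the epsilon loss.\<close>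

lemma power_card_le:
  fixes J x :: real
  assumes "J \<ge> 1" "x > 1"
  shows "\<exists>D\<ge>1. \<forall>W :: 'a::{finite,field} poly set. finite W \<and> 0 \<notin> W \<longrightarrow> J ^ card W \<le> D * x ^ degree (\<Prod>W)"
proof -
  obtain t where t: "J \<le> x ^ t"
    using real_arch_pow[OF assms(2), of J] by (auto intro: less_imp_le)
  let ?L = "lowdeg t :: 'a poly set"
  have fine: "J ^ card W \<le> J ^ card (W \<inter> ?L) * x ^ degree (\<Prod>W)" if "finite W" "0 \<notin> W" for W
    using that
  proof (induction W)
    case (insert p W)
    then have deg: "degree (\<Prod>(insert p W)) = degree p + degree (\<Prod>W)"
      by (subst prod.insert) (auto intro: degree_mult_eq)
    have x: "x ^ degree (\<Prod>W) \<ge> 0" "J ^ card (W \<inter> ?L) \<ge> 0" using assms by auto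
    show ?case
    proof (cases "p \<in> ?L")
      case True
      have "J * J ^ card W \<le> J * (J ^ card (W \<inter> ?L) * (x ^ degree p * x ^ degree (\<Prod>W)))"
      proof -
        have "x ^ degree (\<Prod>W) \<le> x ^ degree p * x ^ degree (\<Prod>W)"
          using assms x by (simp add: mult_le_cancel_right1)
        then have "J ^ card (W \<inter> ?L) * x ^ degree (\<Prod>W) \<le> J ^ card (W \<inter> ?L) * (x ^ degree p * x ^ degree (\<Prod>W))"
          using x(2) by (rule mult_left_mono)
        moreover have "J ^ card W \<le> J ^ card (W \<inter> ?L) * x ^ degree (\<Prod>W)"
          using insert by simp
        ultimately show ?thesis using assms by (intro mult_left_mono) linarith+
      qed
      then show ?thesis using insert True deg by (simp add: power_add mult_ac)
    next
      case False
      then have "t \<le> degree p" by (auto simp: lowdeg_iff)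
      then have "J \<le> x ^ degree p"
        using t assms(2) power_increasing[of t "degree p" x] by linarith
      then have "J * J ^ card W \<le> x ^ degree p * (J ^ card (W \<inter> ?L) * x ^ degree (\<Prod>W))"
        using insert assms by (intro mult_mono) auto
      then show ?thesis using insert False deg by (simp add: power_add mult_ac)
    qed
  qed simp
  have coarse: "J ^ card (W \<inter> ?L) * x ^ degree (\<Prod>W) \<le> J ^ card ?L * x ^ degree (\<Prod>W)" for W
    using assms by (intro mult_right_mono power_increasing card_mono) auto
  have "J ^ card W \<le> J ^ card ?L * x ^ degree (\<Prod>W)" if "finite W" "0 \<notin> W" for W :: "'a poly set"
    by (rule order.trans[OF fine[OF that] coarse])
  then show ?thesis
    using assms by (intro exI[of _ "J ^ card ?L"]) auto
qed

lemma sum_le_card_fibres: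
  assumes "finite A" "finite B" "\<phi> ` A \<subseteq> B" and "\<And>y. y \<in> B \<Longrightarrow> card {a \<in> A. \<phi> a = y} \<le> m"
  shows "card A \<le> card B * m"
proof -
  have "card A = (\<Sum>y\<in>B. card {a \<in> A. \<phi> a = y})"
    using sum.group[OF assms(1-3), of "\<lambda>_. 1::nat"] by simp
  also have "\<dots> \<le> card B * m"
    using sum_mono[of B _ "\<lambda>_. m"] assms(4) by simp
  finally show ?thesis .
qed

section \<open>Euler product estimates, and the primes in the relation b = a + (b - a)\<close>

context prime_poly_set
begin

definition dg :: "'a poly set \<Rightarrow> nat" where
  "dg X = degree (\<Prod>X)"

lemma dg_union: "X \<subseteq> S \<Longrightarrow> Y \<subseteq> S \<Longrightarrow> X \<inter> Y = {} \<Longrightarrow> dg (X \<union> Y) = dg X + dg Y"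
  unfolding dg_def by (subst prod_S_union) (auto intro!: degree_mult_eq prod_S_nonzero)

lemma dg_diff: "X \<subseteq> S \<Longrightarrow> dg (S - X) + dg X = degree Q"
  using dg_union[of "S - X" X] by (simp add: dg_def Un_absorb2 Diff_Int_distrib2 Int_commute)

lemma prod_pnorm_dg: "X \<subseteq> S \<Longrightarrow> (\<Prod>p\<in>X. pnorm p) = real CARD('a) ^ dg X"
  by (simp add: prod_pnorm dg_def)

lemma CARD_real_gt_1: "real CARD('a) > 1"
  using CARD_field_ge_2[where 'a='a] by simp

lemma totient_prod_nonneg [simp]: "X \<subseteq> S \<Longrightarrow> totient_prod X \<ge> 0"
  using totient_prod_pos by (blast intro: less_imp_le)

lemma totient_prod_union:
  "X \<subseteq> S \<Longrightarrow> Y \<subseteq> S \<Longrightarrow> X \<inter> Y = {} \<Longrightarrow> totient_prod (X \<union> Y) = totient_prod X * totient_prod Y"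
  unfolding totient_prod_def by (rule prod.union_disjoint) auto

text \<open>Passing from a divisor to \<open>Q\<close> only multiplies the density by factors at
  most 1.\<close>

lemma norm_div_totient_prod_le:
  assumes "X \<subseteq> S"
  shows "real CARD('a) ^ dg X / totient_prod X \<le> 1 / rho"
proof -
  have "rho = (\<Prod>p\<in>S - X. 1 - 1 / pnorm p) * (\<Prod>p\<in>X. 1 - 1 / pnorm p)"
    unfolding rho_def by (rule prod.subset_diff[OF assms]) simp
  also have "\<dots> \<le> 1 * (\<Prod>p\<in>X. 1 - 1 / pnorm p)"
    using pnorm_gt_1 assms by (intro mult_right_mono prod_le_1 prod_nonneg) (force simp: field_simps)+
  finally have "rho * real CARD('a) ^ dg X \<le> (\<Prod>p\<in>X. 1 - 1 / pnorm p) * real CARD('a) ^ dg X"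
    by (intro mult_right_mono) auto
  also have "\<dots> = totient_prod X"
    unfolding prod_pnorm_dg[OF assms, symmetric] totient_prod_def prod.distrib[symmetric]
    using pnorm_pos subsetD[OF assms] by (intro prod.cong refl) (simp add: left_diff_distrib less_imp_neq[symmetric])
  finally show ?thesis
    using rho_pos totient_prod_pos[OF assms] by (simp add: field_simps)
qed

text \<open>The sum is an Euler product, compared prime by prime with a power of the factor of
  \<open>1 / rho\<close> by Bernoulli's inequality.\<close>

lemma sum_power_card_div_totient_le:
  "(\<Sum>W\<in>Pow S. real j ^ card W / totient_prod W) \<le> (1 / rho) ^ j"
proof -
  have "(\<Sum>W\<in>Pow S. real j ^ card W / totient_prod W) = (\<Prod>p\<in>S. real j / (pnorm p - 1) + 1)"
    unfolding totient_prod_def by (subst prod_add) (auto simp: prod_dividef)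
  also have "\<dots> \<le> (\<Prod>p\<in>S. (1 / (1 - 1 / pnorm p)) ^ j)"
  proof (intro prod_mono conjI)
    fix p assume "p \<in> S"
    then have p: "pnorm p > 1" by (rule pnorm_gt_1)
    then show "0 \<le> real j / (pnorm p - 1) + 1" by simp
    have "1 + real j * (1 / (pnorm p - 1)) \<le> (1 + 1 / (pnorm p - 1)) ^ j"
      using p by (intro Bernoulli_inequality) (auto simp: field_simps)
    also have "1 + 1 / (pnorm p - 1) = 1 / (1 - 1 / pnorm p)"
      using p by (simp add: field_simps)
    finally show "real j / (pnorm p - 1) + 1 \<le> (1 / (1 - 1 / pnorm p)) ^ j"
      by simp
  qed
  also have "\<dots> = (1 / rho) ^ j"
    by (simp add: rho_def prod_power_distrib[symmetric] prod_dividef)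
  finally show ?thesis .
qed

text \<open>The power of q, which will be a count of frequencies, cancels against one totient of
  \<open>K\<close> and \<open>W\<close> at the cost of \<open>1 / rho\<close>; the rest is summed
  over all subsets of \<open>S\<close>.\<close>

lemma sum_weights_le:
  assumes "K \<subseteq> S" and "\<W> \<subseteq> Pow (S - K)"
  shows "(\<Sum>W\<in>\<W>. real CARD('a) ^ (dg K + dg W) * (real m ^ card W / (totient_prod K * (totient_prod W)\<^sup>2)))
    \<le> (1 / rho) ^ (1 + m)"
proof -
  have fin: "finite (Pow S)" and sub: "\<W> \<subseteq> Pow S" using assms by auto
  have "(\<Sum>W\<in>\<W>. real CARD('a) ^ (dg K + dg W) * (real m ^ card W / (totient_prod K * (totient_prod W)\<^sup>2)))
      \<le> (\<Sum>W\<in>\<W>. 1 / rho * (real m ^ card W / totient_prod W))"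
  proof (intro sum_mono)
    fix W assume "W \<in> \<W>"
    then have W: "W \<subseteq> S" "K \<inter> W = {}" using assms by auto
    have "real CARD('a) ^ (dg K + dg W) * (real m ^ card W / (totient_prod K * (totient_prod W)\<^sup>2))
      = real CARD('a) ^ dg (K \<union> W) / totient_prod (K \<union> W) * (real m ^ card W / totient_prod W)"
      using assms W by (simp add: dg_union totient_prod_union power2_eq_square)
    also have "\<dots> \<le> 1 / rho * (real m ^ card W / totient_prod W)"
      using assms W totient_prod_pos[of W] by (intro mult_right_mono norm_div_totient_prod_le) auto
    finally show "real CARD('a) ^ (dg K + dg W) * (real m ^ card W / (totient_prod K * (totient_prod W)\<^sup>2))
      \<le> 1 / rho * (real m ^ card W / totient_prod W)" .
  qed
  also have "\<dots> = 1 / rho * (\<Sum>W\<in>\<W>. real m ^ card W / totient_prod W)"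
    by (simp add: sum_distrib_left)
  also have "\<dots> \<le> 1 / rho * (\<Sum>W\<in>Pow S. real m ^ card W / totient_prod W)"
    using rho_pos by (intro mult_left_mono sum_mono2 fin sub) (auto intro: divide_nonneg_nonneg)
  also have "\<dots> \<le> 1 / rho * (1 / rho) ^ m"
    using rho_pos by (intro mult_left_mono sum_power_card_div_totient_le) auto
  finally show ?thesis by simp
qed

text \<open>For \<open>b = a + (b - a)\<close> these are the prime factors of the quantities \<open>k\<close>, \<open>c\<close> and \<open>y\<close> of the
  introduction; those of \<open>m\<close> are the remaining primes of \<open>supp b\<close>.\<close>

definition shared_primes :: "'a poly \<Rightarrow> 'a poly \<Rightarrow> 'a poly set" where
  "shared_primes b a = supp b \<inter> supp a \<inter> supp (b - a)"

definition cancelled_primes :: "'a poly \<Rightarrow> 'a poly \<Rightarrow> 'a poly set" where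
  "cancelled_primes b a = supp b - supp (b - a)"

definition new_primes :: "'a poly \<Rightarrow> 'a poly \<Rightarrow> 'a poly set" where
  "new_primes b a = supp a - supp b"

lemma supp_triangle:
  "supp b \<subseteq> supp a \<union> supp (b - a)" "supp a \<subseteq> supp b \<union> supp (b - a)" "supp (b - a) \<subseteq> supp b \<union> supp a"
proof -
  have 1: "p dvd b" if "p dvd a" "p dvd b - a" for p
    using dvd_add[OF that] by simp
  have 2: "p dvd a" if "p dvd b" "p dvd b - a" for p
    using dvd_diff[OF that] by simp
  show "supp b \<subseteq> supp a \<union> supp (b - a)" unfolding supp_def using 1 by blast
  show "supp a \<subseteq> supp b \<union> supp (b - a)" unfolding supp_def using 2 by blast
  show "supp (b - a) \<subseteq> supp b \<union> supp a" unfolding supp_def using dvd_diff by blast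
qed

text \<open>A prime dividing two of \<open>b\<close>, \<open>a\<close>, \<open>b - a\<close> divides
  the third. So each prime in one of the denominators lies in exactly two of them or in all
  three.\<close>

lemma supp_decomp:
  "supp a = shared_primes b a \<union> cancelled_primes b a \<union> new_primes b a"
  "supp (b - a) = shared_primes b a \<union> (supp b - shared_primes b a - cancelled_primes b a) \<union> new_primes b a"
  "shared_primes b a \<union> cancelled_primes b a \<union> (supp b - shared_primes b a - cancelled_primes b a) = supp b"
  unfolding shared_primes_def cancelled_primes_def new_primes_def
  using supp_triangle(1)[of b a] supp_triangle(2)[of a b] supp_triangle(3)[of b a] by blast+

lemma decomp_disjoint:
  "shared_primes b a \<inter> cancelled_primes b a = {}" "shared_primes b a \<inter> new_primes b a = {}" "cancelled_primes b a \<inter> new_primes b a = {}" "supp b \<inter> new_primes b a = {}"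
  by (auto simp: shared_primes_def cancelled_primes_def new_primes_def)

lemma suppD: "p \<in> supp a \<Longrightarrow> p \<in> S"
  by (simp add: supp_def)

lemma decomp_subset:
  "shared_primes b a \<subseteq> S" "cancelled_primes b a \<subseteq> S" "new_primes b a \<subseteq> S" "shared_primes b a \<subseteq> supp b" "cancelled_primes b a \<subseteq> supp b"
  by (auto simp: shared_primes_def cancelled_primes_def new_primes_def dest: suppD)

text \<open>The denominators of \<open>a\<close> and \<open>b - a\<close> both contain
  \<open>K\<close> and the new primes, and each prime of \<open>C\<close> and of the rest of
  \<open>supp b\<close> occurs once. One copy of \<open>K\<close> completes the totient of
  \<open>supp b\<close>.\<close>

lemma wt_mult_wt_diff:
  assumes "a \<noteq> 0" "b \<noteq> a" and KC: "shared_primes b a = K" "cancelled_primes b a = C"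
  shows "wt i a * wt j (b - a) =
    real (i * j) ^ card K * real i ^ card C * real j ^ card (supp b - K - C) / totient_prod (supp b) *
      (real (i * j) ^ card (new_primes b a) / (totient_prod K * (totient_prod (new_primes b a))\<^sup>2))"
proof -
  define M where "M = supp b - K - C"
  define W where "W = new_primes b a"
  have sub: "K \<subseteq> S" "C \<subseteq> S" "M \<subseteq> S" "W \<subseteq> S"
    using KC decomp_subset[of b a] by (auto simp: M_def W_def dest: suppD)
  then have fin: "finite K" "finite C" "finite M" "finite W" by auto
  have disj: "K \<inter> C = {}" "K \<inter> W = {}" "C \<inter> W = {}" "K \<inter> M = {}" "C \<inter> M = {}" "M \<inter> W = {}"
    using decomp_disjoint[of b a] KC by (auto simp: M_def W_def)
  have eq: "supp a = K \<union> C \<union> W" "supp (b - a) = K \<union> M \<union> W" "supp b = K \<union> C \<union> M"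
    using supp_decomp(1)[of a b] supp_decomp(2,3)[of b a] unfolding KC M_def W_def by auto
  have tot: "totient_prod (A \<union> B \<union> D) = totient_prod A * totient_prod B * totient_prod D"
    if "A \<subseteq> S" "B \<subseteq> S" "D \<subseteq> S" "A \<inter> B = {}" "A \<inter> D = {}" "B \<inter> D = {}" for A B D
    using that by (subst totient_prod_union) (auto simp: totient_prod_union)
  have crd: "card (A \<union> B \<union> D) = card A + card B + card D"
    if "finite A" "finite B" "finite D" "A \<inter> B = {}" "A \<inter> D = {}" "B \<inter> D = {}" for A B D :: "'a poly set"
    using that by (subst card_Un_disjoint) (auto simp: card_Un_disjoint)
  have "wt i a * wt j (b - a) = real i ^ (card K + card C + card W) / (totient_prod K * totient_prod C * totient_prod W)
     * (real j ^ (card K + card M + card W) / (totient_prod K * totient_prod M * totient_prod W))"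
    using assms(1,2) sub fin disj unfolding wt_def eq by (simp add: tot crd)
  also have "\<dots> = real (i * j) ^ card K * real i ^ card C * real j ^ card M / totient_prod (supp b) *
      (real (i * j) ^ card W / (totient_prod K * (totient_prod W)\<^sup>2))"
    unfolding eq using sub fin disj by (simp add: tot power_add power_mult_distrib power2_eq_square mult_ac)
  finally show ?thesis unfolding M_def W_def .
qed

text \<open>Each prime of \<open>supp b\<close> falls into one of three classes, contributing
  \<open>i * j\<close>, \<open>i\<close> or \<open>j\<close>; by the multinomial theorem a bound
  uniform in the classes gives back a weight of \<open>b\<close> of the same type.\<close>

lemma sum_wt_mult_wt_diff_le:
  assumes "b \<noteq> 0" "finite A" and A: "\<And>a. a \<in> A \<Longrightarrow> a \<noteq> 0 \<and> b \<noteq> a"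
    and bound: "\<And>K C. K \<subseteq> supp b \<Longrightarrow> C \<subseteq> supp b - K \<Longrightarrow>
      (\<Sum>a | a \<in> A \<and> shared_primes b a = K \<and> cancelled_primes b a = C.
        real (i * j) ^ card (new_primes b a) / (totient_prod K * (totient_prod (new_primes b a))\<^sup>2)) \<le> B"
  shows "(\<Sum>a\<in>A. wt i a * wt j (b - a)) \<le> B * wt (i * j + i + j) b"
proof -
  let ?X = "supp b"
  let ?I = "SIGMA K:Pow ?X. Pow (?X - K)"
  let ?c = "\<lambda>K C. real (i * j) ^ card K * real i ^ card C * real j ^ card (?X - K - C)"
  have finI: "finite ?I" by auto
  have "(\<lambda>a. (shared_primes b a, cancelled_primes b a)) ` A \<subseteq> ?I"
    using decomp_disjoint by (force simp: shared_primes_def cancelled_primes_def)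
  from sum.group[OF assms(2) finI this, of "\<lambda>a. wt i a * wt j (b - a)"]
  have "(\<Sum>a\<in>A. wt i a * wt j (b - a))
    = (\<Sum>(K,C)\<in>?I. \<Sum>a | a \<in> A \<and> shared_primes b a = K \<and> cancelled_primes b a = C. wt i a * wt j (b - a))"
    by (simp add: case_prod_unfold prod_eq_iff)
  also have "\<dots> \<le> (\<Sum>(K,C)\<in>?I. ?c K C / totient_prod ?X * B)"
  proof (intro sum_mono, clarify)
    fix K C assume KC: "K \<subseteq> ?X" "C \<subseteq> ?X - K"
    have "(\<Sum>a | a \<in> A \<and> shared_primes b a = K \<and> cancelled_primes b a = C. wt i a * wt j (b - a))
      = ?c K C / totient_prod ?X * (\<Sum>a | a \<in> A \<and> shared_primes b a = K \<and> cancelled_primes b a = C.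
        real (i * j) ^ card (new_primes b a) / (totient_prod K * (totient_prod (new_primes b a))\<^sup>2))"
      unfolding sum_distrib_left using A by (intro sum.cong refl wt_mult_wt_diff) auto
    also have "\<dots> \<le> ?c K C / totient_prod ?X * B"
      using totient_prod_pos[OF supp_subset[of b]] by (intro mult_left_mono bound KC) simp
    finally show "(\<Sum>a | a \<in> A \<and> shared_primes b a = K \<and> cancelled_primes b a = C. wt i a * wt j (b - a))
       \<le> ?c K C / totient_prod ?X * B" .
  qed
  also have "\<dots> = (\<Sum>(K,C)\<in>?I. ?c K C) * (B / totient_prod ?X)"
    unfolding sum_distrib_right by (intro sum.cong) auto
  also have "(\<Sum>(K,C)\<in>?I. ?c K C) = (\<Sum>K\<in>Pow ?X. \<Sum>C\<in>Pow (?X - K). ?c K C)"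
    by (subst sum.Sigma) auto
  also have "\<dots> = (\<Sum>K\<in>Pow ?X. real (i * j) ^ card K * (real i + real j) ^ card (?X - K))"
  proof (intro sum.cong refl)
    fix K
    have "(\<Prod>p\<in>?X - K. real i + real j) = (\<Sum>C\<in>Pow (?X - K). (\<Prod>p\<in>C. real i) * (\<Prod>p\<in>?X - K - C. real j))"
      by (rule prod_add) simp
    then show "(\<Sum>C\<in>Pow (?X - K). ?c K C) = real (i * j) ^ card K * (real i + real j) ^ card (?X - K)"
      by (simp add: sum_distrib_left mult.assoc)
  qed
  also have "\<dots> = (\<Prod>p\<in>?X. real (i * j) + (real i + real j))"
    by (subst prod_add) auto
  also have "\<dots> * (B / totient_prod ?X) = B * wt (i * j + i + j) b"
    using assms(1) by (simp add: wt_def add.assoc)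
  finally show ?thesis .
qed

text \<open>All these \<open>a\<close> agree modulo every prime outside \<open>K\<close> and
  \<open>W\<close>: they are congruent to \<open>b\<close> at the primes of \<open>C\<close> and to
  0 at the others.\<close>

lemma card_fibre_le:
  assumes "K \<subseteq> supp b" "C \<subseteq> supp b - K" "W \<subseteq> S - K"
  shows "card {a \<in> lowdeg (degree Q - h). shared_primes b a = K \<and> cancelled_primes b a = C \<and> new_primes b a = W}
    \<le> CARD('a) ^ (dg K + dg W - h)" (is "card ?A \<le> _")
proof -
  let ?R = "S - (K \<union> W)"
  have sub: "K \<subseteq> S" "W \<subseteq> S" "K \<inter> W = {}" "?R \<subseteq> S" using assms by (auto dest: suppD)
  have "degree Q = dg ?R + (dg K + dg W)"
    using dg_diff[of "K \<union> W"] dg_union[of K W] sub by auto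
  then have deg: "degree Q - h - degree (\<Prod>?R) \<le> dg K + dg W - h"
    unfolding dg_def[of ?R, symmetric] by arith
  have "x - y \<in> lowdeg (degree Q - h) \<and> \<Prod>?R dvd x - y" if "x \<in> ?A" "y \<in> ?A" for x y
  proof -
    have "p dvd x - y" if p: "p \<in> ?R" for p
    proof (cases "p \<in> C")
      case True
      then have "p dvd b - x" "p dvd b - y"
        using \<open>x \<in> ?A\<close> \<open>y \<in> ?A\<close> p by (auto simp: cancelled_primes_def supp_def)
      then show ?thesis using dvd_diff[of p "b - y" "b - x"] by simp
    next
      case False
      have "supp x = K \<union> C \<union> W" "supp y = K \<union> C \<union> W"
        using \<open>x \<in> ?A\<close> \<open>y \<in> ?A\<close> supp_decomp(1)[of x b] supp_decomp(1)[of y b] by auto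
      then have "p \<notin> supp x" "p \<notin> supp y" using False p by auto
      then show ?thesis using p by (auto simp: supp_def)
    qed
    then show ?thesis using that sub by (auto simp: prod_S_dvd_iff)
  qed
  from card_congruent_lowdeg_le(2)[OF prod_S_nonzero[OF sub(4)] this]
  have "card ?A \<le> CARD('a) ^ (degree Q - h - degree (\<Prod>?R))" .
  also have "\<dots> \<le> CARD('a) ^ (dg K + dg W - h)"
    using deg by (intro power_increasing) auto
  finally show ?thesis .
qed

text \<open>\<open>N\<close> is the saving over the trivial count. \<open>N = 1\<close> is always
  admissible; \<open>q ^ h\<close> is admissible when the subtraction of \<open>h\<close> is never
  truncated.\<close>

lemma sum_by_new_le:
  assumes "K \<subseteq> supp b" "C \<subseteq> supp b - K"
    and A: "A \<subseteq> {a \<in> lowdeg (degree Q - h). shared_primes b a = K \<and> cancelled_primes b a = C}"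
    and N: "N > 0" "\<And>a. a \<in> A \<Longrightarrow> real CARD('a) ^ (dg K + dg (new_primes b a) - h) \<le> real CARD('a) ^ (dg K + dg (new_primes b a)) / N"
  shows "(\<Sum>a\<in>A. real m ^ card (new_primes b a) / (totient_prod K * (totient_prod (new_primes b a))\<^sup>2)) \<le> (1 / rho) ^ (1 + m) / N"
proof -
  let ?g = "\<lambda>W. real m ^ card W / (totient_prod K * (totient_prod W)\<^sup>2)"
  have KS: "K \<subseteq> S" using assms(1) by (auto dest: suppD)
  have finA: "finite A" using A by (rule finite_subset) auto
  have new: "new_primes b a \<subseteq> S - K" if "a \<in> A" for a
    using that A decomp_disjoint(2)[of b a] decomp_subset(3)[of b a] by auto
  have g: "?g W \<ge> 0" if "W \<subseteq> S" for W
    using totient_prod_pos[OF KS] by simp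
  have "(\<Sum>a\<in>A. ?g (new_primes b a)) = (\<Sum>W\<in>new_primes b ` A. \<Sum>a | a \<in> A \<and> new_primes b a = W. ?g (new_primes b a))"
    by (rule sum.image_gen[OF finA])
  also have "\<dots> \<le> (\<Sum>W\<in>new_primes b ` A. real CARD('a) ^ (dg K + dg W) / N * ?g W)"
  proof (intro sum_mono)
    fix W assume "W \<in> new_primes b ` A"
    then obtain a where a: "a \<in> A" "W = new_primes b a" by blast
    then have W: "W \<subseteq> S - K" using new by auto
    have "card {a \<in> A. new_primes b a = W} \<le> card {a \<in> lowdeg (degree Q - h). shared_primes b a = K \<and> cancelled_primes b a = C \<and> new_primes b a = W}"
      using A by (intro card_mono) auto
    also have "\<dots> \<le> CARD('a) ^ (dg K + dg W - h)"
      by (rule card_fibre_le[OF assms(1,2) W])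
    finally have "real (card {a \<in> A. new_primes b a = W}) \<le> real CARD('a) ^ (dg K + dg W - h)"
      by (metis of_nat_le_iff of_nat_power)
    also have "\<dots> \<le> real CARD('a) ^ (dg K + dg W) / N" using N(2) a by simp
    finally have "real (card {a \<in> A. new_primes b a = W}) * ?g W \<le> real CARD('a) ^ (dg K + dg W) / N * ?g W"
      using W by (intro mult_right_mono g) auto
    then show "(\<Sum>a | a \<in> A \<and> new_primes b a = W. ?g (new_primes b a)) \<le> real CARD('a) ^ (dg K + dg W) / N * ?g W"
      by simp
  qed
  also have "\<dots> = (\<Sum>W\<in>new_primes b ` A. real CARD('a) ^ (dg K + dg W) * ?g W) / N"
    by (simp add: sum_divide_distrib mult_ac)
  also have "\<dots> \<le> (1 / rho) ^ (1 + m) / N"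
    using N(1) new by (intro divide_right_mono sum_weights_le KS) auto
  finally show ?thesis .
qed

end

section \<open>Counting solutions of three-term relations\<close>

context prime_poly_set
begin

lemma lead_coeff_prod_S: "X \<subseteq> S \<Longrightarrow> lead_coeff (\<Prod>X) = 1"
proof -
  assume X: "X \<subseteq> S"
  then have "finite X" by simp
  then show ?thesis using X monic_S by (induction X) (auto simp: lead_coeff_mult)
qed

lemma prod_S_inj:
  assumes "X \<subseteq> S" "Y \<subseteq> S" "\<Prod>X = \<Prod>Y"
  shows "X = Y"
  using prime_dvd_prod_S_iff[OF _ assms(1)] prime_dvd_prod_S_iff[OF _ assms(2)] assms by auto

lemma prod_S_diff_lowdeg:
  assumes "X \<subseteq> S" "Y \<subseteq> S" "dg X = t" "dg Y = t"
  shows "\<Prod>X - \<Prod>Y \<in> lowdeg t"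
proof -
  have "coeff (\<Prod>X) i = coeff (\<Prod>Y) i" if "i \<ge> t" for i
  proof (cases "i = t")
    case True
    then show ?thesis
      using lead_coeff_prod_S[OF assms(1)] lead_coeff_prod_S[OF assms(2)] assms(3,4) by (simp add: dg_def)
  next
    case False
    then show ?thesis using that assms(3,4) by (simp add: dg_def coeff_eq_0)
  qed
  then show ?thesis by (simp add: lowdeg_def)
qed

text \<open>The numerator of a/Q in lowest terms.\<close>

definition cofactor :: "'a poly \<Rightarrow> 'a poly" where
  "cofactor a = a div \<Prod>(S - supp a)"

lemma cofactor_mult: "\<Prod>(S - supp a) * cofactor a = a"
proof -
  have "\<Prod>(S - supp a) dvd a"
    by (subst prod_S_dvd_iff) (auto simp: supp_def)
  then show ?thesis by (simp add: cofactor_def)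
qed

lemma cofactor_lowdeg:
  assumes "a \<in> lowdeg (degree Q - h)" "a \<noteq> 0"
  shows "cofactor a \<in> lowdeg (dg (supp a) - h)" "cofactor a \<noteq> 0"
proof -
  show ne: "cofactor a \<noteq> 0" using cofactor_mult[of a] assms(2) by auto
  have "degree a = dg (S - supp a) + degree (cofactor a)"
    unfolding dg_def using ne by (subst cofactor_mult[of a, symmetric]) (intro degree_mult_eq prod_S_nonzero, auto)
  moreover have "dg (S - supp a) + dg (supp a) = degree Q"
    by (rule dg_diff) simp
  ultimately show "cofactor a \<in> lowdeg (dg (supp a) - h)"
    using assms by (auto simp: lowdeg_iff)
qed

lemma not_dvd_cofactor: "p \<in> supp a \<Longrightarrow> \<not> p dvd cofactor a"
  using cofactor_mult[of a] by (metis (mono_tags, lifting) dvd_mult mem_Collect_eq supp_def)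

text \<open>Clearing denominators in \<open>b = a + (b - a)\<close>: modulo the primes of \<open>cancelled_primes b a\<close>, which cancel in
  \<open>b - a\<close>, the product over \<open>new_primes b a\<close> is a fixed multiple of the cofactor of \<open>a\<close>.\<close>

lemma cancelled_prime_dvd_cofactor_relation:
  assumes "p \<in> cancelled_primes b a"
  shows "p dvd \<Prod>(new_primes b a) * cofactor b - \<Prod>(supp b - shared_primes b a - cancelled_primes b a) * cofactor a"
proof -
  \<comment> \<open>The primes dividing both \<open>a\<close> and \<open>b\<close>. Their product is
    taken out of \<open>b - a\<close>; a cancelled prime is not among them.\<close>
  define U where "U = S - (supp b \<union> new_primes b a)"
  let ?M = "supp b - shared_primes b a - cancelled_primes b a"
  have p: "p \<in> S" "p \<in> supp b" using assms by (auto simp: cancelled_primes_def dest: suppD)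
  have sub: "U \<subseteq> S" "?M \<subseteq> S" "new_primes b a \<subseteq> S" using decomp_subset[of b a] by (auto simp: U_def dest: suppD)
  have Sb: "S - supp b = U \<union> new_primes b a"
    using decomp_disjoint(4)[of b a] sub by (auto simp: U_def)
  have "\<Prod>(S - supp b) = \<Prod>U * \<Prod>(new_primes b a)"
    unfolding Sb by (rule prod_S_union) (use sub in \<open>auto simp: U_def\<close>)
  then have b: "b = \<Prod>U * \<Prod>(new_primes b a) * cofactor b"
    using cofactor_mult[of b] by metis
  have "S - supp a = U \<union> ?M" "U \<inter> ?M = {}"
    using supp_decomp(1)[of a b] decomp_disjoint[of b a] sub(2) supp_decomp(3)[of b a] unfolding U_def by blast+
  then have "\<Prod>(S - supp a) = \<Prod>U * \<Prod>?M"
    using sub by (simp only: prod_S_union)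
  then have a: "a = \<Prod>U * \<Prod>?M * cofactor a"
    using cofactor_mult[of a] by metis
  have "b - a = \<Prod>U * \<Prod>(new_primes b a) * cofactor b - \<Prod>U * \<Prod>?M * cofactor a"
    by (rule arg_cong2[where f = minus, OF b a])
  also have "\<dots> = \<Prod>U * (\<Prod>(new_primes b a) * cofactor b - \<Prod>?M * cofactor a)"
    by (simp only: mult.assoc right_diff_distrib)
  finally have "b - a = \<Prod>U * (\<Prod>(new_primes b a) * cofactor b - \<Prod>?M * cofactor a)" .
  moreover have "p dvd b - a" using assms p by (auto simp: cancelled_primes_def supp_def)
  ultimately have "p dvd \<Prod>U \<or> p dvd \<Prod>(new_primes b a) * cofactor b - \<Prod>?M * cofactor a"
    using prime_S[OF p(1)] by (simp add: prime_elem_dvd_mult_iff)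
  moreover have "\<not> p dvd \<Prod>U"
    using p sub by (simp add: prime_dvd_prod_S_iff) (simp add: U_def)
  ultimately show ?thesis by blast
qed

text \<open>The numerator of \<open>a\<close> is chosen first. The cofactor relation then fixes the
  product of the new primes modulo \<open>C\<close>; being monic of degree \<open>t\<close>, it has
  \<open>q ^ (t - dg C)\<close> possible values, and \<open>dg C \<le> t\<close> makes this the
  expected number.\<close>

lemma card_pairs_le:
  fixes h :: nat
  assumes KC: "K \<subseteq> supp b" "C \<subseteq> supp b - K" and t: "dg C \<le> t"
  defines "E \<equiv> {a \<in> lowdeg (degree Q - h). a \<noteq> 0 \<and> shared_primes b a = K \<and> cancelled_primes b a = C \<and> dg (new_primes b a) = t}"
  shows "real (card E) \<le> real CARD('a) ^ (dg K + 2 * t) / real CARD('a) ^ h"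
proof -
  have sub: "K \<subseteq> S" "C \<subseteq> S" "K \<inter> C = {}" using KC by (auto dest: suppD)
  define s where "s = dg K + dg C + t"
  have supp_E: "supp a = K \<union> C \<union> new_primes b a" "dg (supp a) = s" if "a \<in> E" for a
  proof -
    show eq: "supp a = K \<union> C \<union> new_primes b a"
      using that supp_decomp(1)[of a b] by (auto simp: E_def)
    have "K \<inter> new_primes b a = {}" "C \<inter> new_primes b a = {}"
      using that decomp_disjoint[of b a] by (auto simp: E_def)
    then show "dg (supp a) = s"
      unfolding eq using sub decomp_subset(3)[of b a] that
      by (subst dg_union) (auto simp: dg_union s_def E_def)
  qed
  have finE: "finite E" by (simp add: E_def)
  have img: "cofactor ` E \<subseteq> lowdeg (s - h) - {0}"
    using cofactor_lowdeg supp_E(2) by (force simp: E_def)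
  have fibre: "card {a \<in> E. cofactor a = y} \<le> CARD('a) ^ (t - dg C)" for y
  proof -
    let ?F = "{a \<in> E. cofactor a = y}"
    let ?g = "\<lambda>a. \<Prod>(new_primes b a)"
    \<comment> \<open>The new primes determine the denominator of \<open>a\<close>, and the
      numerator is fixed.\<close>
    have inj: "inj_on ?g ?F"
    proof (rule inj_onI)
      fix a a' assume a: "a \<in> ?F" "a' \<in> ?F" "?g a = ?g a'"
      have "new_primes b a = new_primes b a'"
        by (rule prod_S_inj[OF decomp_subset(3) decomp_subset(3) a(3)])
      then have "supp a = supp a'" using a supp_E(1) by simp
      then show "a = a'" using a cofactor_mult[of a] cofactor_mult[of a'] by simp
    qed
    have "z - z' \<in> lowdeg t \<and> \<Prod>C dvd z - z'" if z: "z \<in> ?g ` ?F" "z' \<in> ?g ` ?F" for z z'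
    proof -
      from z(1) obtain a where a: "z = ?g a" "a \<in> ?F" by (rule imageE)
      from z(2) obtain a' where a': "z' = ?g a'" "a' \<in> ?F" by (rule imageE)
      have "p dvd z - z'" if p: "p \<in> C" for p
      proof -
        let ?m = "\<Prod>(supp b - K - C) * y"
        have "p dvd z * cofactor b - ?m" "p dvd z' * cofactor b - ?m"
          using cancelled_prime_dvd_cofactor_relation[of p b a] cancelled_prime_dvd_cofactor_relation[of p b a'] a a' p
          by (auto simp: E_def)
        then have "p dvd (z * cofactor b - ?m) - (z' * cofactor b - ?m)" by (rule dvd_diff)
        then have "p dvd (z - z') * cofactor b" by (simp add: algebra_simps)
        moreover have "\<not> p dvd cofactor b" using p KC by (intro not_dvd_cofactor) auto
        ultimately show ?thesis
          using prime_S[of p] p sub by (auto simp: prime_elem_dvd_mult_iff)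
      qed
      moreover have "z - z' \<in> lowdeg t"
        unfolding a(1) a'(1) using a(2) a'(2) decomp_subset(3)
        by (intro prod_S_diff_lowdeg) (auto simp: E_def)
      ultimately show ?thesis using sub by (simp add: prod_S_dvd_iff)
    qed
    from card_congruent_lowdeg_le(2)[OF prod_S_nonzero[OF sub(2)] this]
    have "card (?g ` ?F) \<le> CARD('a) ^ (t - dg C)" by (simp add: dg_def)
    then show ?thesis using inj by (simp add: card_image)
  qed
  show ?thesis
  proof (cases "s \<le> h")
    \<comment> \<open>No nonzero numerator is left, whereas the truncated count would still give at
      least 1.\<close>
    case True
    then have "E = {}" using img by (auto simp: image_subset_iff)
    then show ?thesis by simp
  next
    case False
    have "card E \<le> card (lowdeg (s - h) :: 'a poly set) * CARD('a) ^ (t - dg C)"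
      using img by (intro sum_le_card_fibres[OF finE _ _ fibre]) auto
    also have "\<dots> = CARD('a) ^ (s - h + (t - dg C))"
      by (simp add: card_lowdeg power_add)
    also have "s - h + (t - dg C) = dg K + 2 * t - h"
      using False t by (simp add: s_def)
    finally have "real (card E) \<le> real CARD('a) ^ (dg K + 2 * t - h)"
      by (metis of_nat_le_iff of_nat_power)
    also have "\<dots> = real CARD('a) ^ (dg K + 2 * t) / real CARD('a) ^ h"
      using False t by (subst power_diff) (auto simp: s_def)
    finally show ?thesis .
  qed
qed

section \<open>Weighted sums deduced from the counts\<close>

lemma totient_prod_ge_half:
  assumes "W \<subseteq> S"
  shows "real CARD('a) ^ dg W \<le> 2 ^ card W * totient_prod W"
proof -
  have "real CARD('a) ^ dg W \<le> (\<Prod>p\<in>W. 2 * (pnorm p - 1))"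
    unfolding prod_pnorm_dg[OF assms, symmetric]
    using pnorm_ge_2 assms by (intro prod_mono) force
  also have "\<dots> = 2 ^ card W * totient_prod W"
    by (simp only: prod.distrib prod_constant totient_prod_def)
  finally show ?thesis .
qed

text \<open>Sorted by the degree \<open>t\<close> of the new part, the count cancels the square of
  its norm in the weight. What remains is \<open>x ^ t\<close>, summed geometrically over
  \<open>t < h\<close>; the 2 in \<open>2 * real m\<close> pays for replacing one totient by a
  norm.\<close>

lemma sum_pairs_le:
  assumes KC: "K \<subseteq> supp b" "C \<subseteq> supp b - K"
    and D: "\<And>W. W \<subseteq> S \<Longrightarrow> (2 * real m) ^ card W \<le> D * x ^ dg W" "D \<ge> 1" and x: "x > 1"
    and A: "A \<subseteq> {a \<in> lowdeg (degree Q - h). a \<noteq> 0 \<and> shared_primes b a = K \<and> cancelled_primes b a = C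
      \<and> dg C \<le> dg (new_primes b a) \<and> dg (new_primes b a) < h}"
  shows "(\<Sum>a\<in>A. real m ^ card (new_primes b a) / (totient_prod K * (totient_prod (new_primes b a))\<^sup>2))
    \<le> D / (x - 1) * x ^ h / (rho * real CARD('a) ^ h)"
proof -
  let ?q = "real CARD('a)"
  let ?g = "\<lambda>W. real m ^ card W / (totient_prod K * (totient_prod W)\<^sup>2)"
  have KS: "K \<subseteq> S" using KC(1) by (auto dest: suppD)
  have finA: "finite A" using A by (rule finite_subset) auto
  have q: "?q > 1" by (rule CARD_real_gt_1)
  have term_le: "?g W \<le> D * x ^ dg W / (rho * ?q ^ (dg K + 2 * dg W))" if W: "W \<subseteq> S" "K \<inter> W = {}" for W
  proof -
    have pos: "totient_prod W > 0" "totient_prod K > 0" using W KS by (auto intro: totient_prod_pos)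
    have "?q ^ dg W * real m ^ card W / totient_prod W \<le> 2 ^ card W * totient_prod W * real m ^ card W / totient_prod W"
      using totient_prod_ge_half[OF W(1)] pos by (intro divide_right_mono mult_right_mono) auto
    also have "\<dots> = (2 * real m) ^ card W" using pos by (simp add: power_mult_distrib)
    also have "\<dots> \<le> D * x ^ dg W" by (rule D(1)[OF W(1)])
    finally have 1: "?q ^ dg W * real m ^ card W / totient_prod W \<le> D * x ^ dg W" .
    have 2: "?q ^ (dg K + dg W) / (totient_prod K * totient_prod W) \<le> 1 / rho"
      using norm_div_totient_prod_le[of "K \<union> W"] W KS by (simp add: dg_union totient_prod_union)
    have "?q ^ (dg K + 2 * dg W) = ?q ^ dg W * ?q ^ (dg K + dg W)"
      by (simp add: mult_2 add_ac flip: power_add)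
    then have "?q ^ (dg K + 2 * dg W) * ?g W
      = (?q ^ dg W * real m ^ card W / totient_prod W) * (?q ^ (dg K + dg W) / (totient_prod K * totient_prod W))"
      by (simp add: power2_eq_square mult_ac)
    also have "\<dots> \<le> (D * x ^ dg W) * (1 / rho)"
      using 1 2 D(2) x pos by (intro mult_mono) auto
    finally show ?thesis
      using q rho_pos by (simp add: field_simps)
  qed
  have "(\<lambda>a. dg (new_primes b a)) ` A \<subseteq> {..<h}" using A by auto
  from sum.group[OF finA _ this, of "\<lambda>a. ?g (new_primes b a)"]
  have "(\<Sum>a\<in>A. ?g (new_primes b a)) = (\<Sum>t<h. \<Sum>a | a \<in> A \<and> dg (new_primes b a) = t. ?g (new_primes b a))"
    by simp
  also have "\<dots> \<le> (\<Sum>t<h. D * x ^ t / (rho * ?q ^ h))"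
  proof (intro sum_mono)
    fix t
    let ?E = "{a \<in> A. dg (new_primes b a) = t}"
    show "(\<Sum>a\<in>?E. ?g (new_primes b a)) \<le> D * x ^ t / (rho * ?q ^ h)"
    proof (cases "?E = {}")
      case True
      then show ?thesis using D(2) x rho_pos by (simp only: sum.empty) simp
    next
      case False
      then have t: "dg C \<le> t" using A by auto
      let ?B = "D * x ^ t / (rho * ?q ^ (dg K + 2 * t))"
      have B: "?B \<ge> 0" using D(2) x rho_pos by simp
      have "(\<Sum>a\<in>?E. ?g (new_primes b a)) \<le> real (card ?E) * ?B"
      proof (rule sum_bounded_above)
        fix a assume a: "a \<in> ?E"
        then have "K \<inter> new_primes b a = {}" using A decomp_disjoint(2)[of b a] by auto
        from term_le[OF decomp_subset(3) this] show "?g (new_primes b a) \<le> ?B" using a by simp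
      qed
      also have "\<dots> \<le> (?q ^ (dg K + 2 * t) / ?q ^ h) * ?B"
      proof (rule mult_right_mono[OF _ B])
        let ?E' = "{a \<in> lowdeg (degree Q - h). a \<noteq> 0 \<and> shared_primes b a = K \<and> cancelled_primes b a = C \<and> dg (new_primes b a) = t}"
        have "card ?E \<le> card ?E'" using A by (intro card_mono) auto
        then show "real (card ?E) \<le> ?q ^ (dg K + 2 * t) / ?q ^ h"
          using card_pairs_le[OF KC t, of h] by linarith
      qed
      also have "\<dots> = D * x ^ t / (rho * ?q ^ h)"
        by simp
      finally show ?thesis .
    qed
  qed
  also have "\<dots> = D / (rho * ?q ^ h) * (\<Sum>t<h. x ^ t)"
    by (simp add: sum_distrib_left)
  also have "(\<Sum>t<h. x ^ t) \<le> x ^ h / (x - 1)"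
    using x by (subst geometric_sum) (auto intro: divide_right_mono)
  then have "D / (rho * ?q ^ h) * (\<Sum>t<h. x ^ t) \<le> D / (rho * ?q ^ h) * (x ^ h / (x - 1))"
    using D(2) rho_pos by (intro mult_left_mono) auto
  also have "\<dots> = D / (x - 1) * x ^ h / (rho * ?q ^ h)" by simp
  finally show ?thesis .
qed

text \<open>The trivial bound, with no saving in \<open>h\<close>: it serves to replace the inner
  convolution by a weight.\<close>

lemma conv_wt_1_le:
  assumes "b \<noteq> 0"
  shows "conv h (wt 1) b \<le> (1 / rho) ^ 2 * wt 3 b"
proof -
  let ?A = "{a \<in> lowdeg (degree Q - h). a \<noteq> 0 \<and> b \<noteq> a}"
  have "conv h (wt 1) b = (\<Sum>a\<in>?A. wt 1 a * wt 1 (b - a))"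
    unfolding conv_def by (intro sum.mono_neutral_right) auto
  also have "\<dots> \<le> (1 / rho) ^ 2 * wt (1 * 1 + 1 + 1) b"
  proof (rule sum_wt_mult_wt_diff_le[OF assms])
    fix K C assume KC: "K \<subseteq> supp b" "C \<subseteq> supp b - K"
    have "(\<Sum>a | a \<in> ?A \<and> shared_primes b a = K \<and> cancelled_primes b a = C.
        real (1 * 1) ^ card (new_primes b a) / (totient_prod K * (totient_prod (new_primes b a))\<^sup>2)) \<le> (1 / rho) ^ (1 + 1 * 1) / 1"
      using CARD_real_gt_1 by (intro sum_by_new_le[OF KC, where h = h]) (auto intro!: power_increasing)
    then show "(\<Sum>a | a \<in> ?A \<and> shared_primes b a = K \<and> cancelled_primes b a = C.
        real (1 * 1) ^ card (new_primes b a) / (totient_prod K * (totient_prod (new_primes b a))\<^sup>2)) \<le> (1 / rho) ^ 2"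
      by (simp add: numeral_2_eq_2)
  qed auto
  finally show ?thesis by (simp add: numeral_3_eq_3)
qed

text \<open>Here one factor \<open>q ^ h\<close> is saved. If \<open>K\<close> and the new primes
  have total degree at least \<open>h\<close>, the fibres have at most their expected size.
  Otherwise the new part has degree below \<open>h\<close>, which caps the divisor loss at
  \<open>x ^ h\<close>, and the pair count applies.\<close>

lemma sum_wt_larger_le:
  assumes b: "b \<noteq> 0"
    and D: "\<And>W. W \<subseteq> S \<Longrightarrow> (2 * real (i * j)) ^ card W \<le> D * x ^ dg W" "D \<ge> 1" and x: "x > 1"
  shows "(\<Sum>a | a \<in> lowdeg (degree Q - h) \<and> dg (supp b) \<le> dg (supp (b - a)). wt i a * wt j (b - a))
    \<le> (1 + D / (x - 1)) * (x ^ h / real CARD('a) ^ h) * (1 / rho) ^ (1 + i * j) * wt (i * j + i + j) b"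
    (is "?lhs \<le> _")
proof -
  let ?q = "real CARD('a)"
  let ?m = "i * j"
  let ?A = "{a \<in> lowdeg (degree Q - h). dg (supp b) \<le> dg (supp (b - a)) \<and> a \<noteq> 0 \<and> b \<noteq> a}"
  have "?lhs = (\<Sum>a\<in>?A. wt i a * wt j (b - a))"
    by (intro sum.mono_neutral_right) auto
  also have "\<dots> \<le> (1 + D / (x - 1)) * (x ^ h / ?q ^ h) * (1 / rho) ^ (1 + i * j) * wt (i * j + i + j) b"
  proof (rule sum_wt_mult_wt_diff_le[OF b])
    fix K C assume KC: "K \<subseteq> supp b" "C \<subseteq> supp b - K"
    let ?g = "\<lambda>a. real ?m ^ card (new_primes b a) / (totient_prod K * (totient_prod (new_primes b a))\<^sup>2)"
    let ?AKC = "{a \<in> ?A. shared_primes b a = K \<and> cancelled_primes b a = C}"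
    let ?big = "{a \<in> ?AKC. h \<le> dg K + dg (new_primes b a)}"
    let ?small = "{a \<in> ?AKC. \<not> h \<le> dg K + dg (new_primes b a)}"
    have split: "?big \<union> ?small = ?AKC" by blast
    have "sum ?g (?big \<union> ?small) = sum ?g ?big + sum ?g ?small"
      by (rule sum.union_disjoint) auto
    then have sum_split: "(\<Sum>a\<in>?AKC. ?g a) = (\<Sum>a\<in>?big. ?g a) + (\<Sum>a\<in>?small. ?g a)"
      unfolding split .
    have big: "(\<Sum>a\<in>?big. ?g a) \<le> (1 / rho) ^ (1 + ?m) / ?q ^ h"
    proof (rule sum_by_new_le[OF KC, where h = h])
      fix a assume "a \<in> ?big"
      then have "h \<le> dg K + dg (new_primes b a)" by blast
      then show "?q ^ (dg K + dg (new_primes b a) - h) \<le> ?q ^ (dg K + dg (new_primes b a)) / ?q ^ h"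
        by (simp add: power_diff)
    next
      show "?big \<subseteq> {a \<in> lowdeg (degree Q - h). shared_primes b a = K \<and> cancelled_primes b a = C}"
        by (rule subsetI) simp
      show "0 < ?q ^ h"
        using CARD_real_gt_1 by (intro zero_less_power) simp
    qed
    have small: "(\<Sum>a\<in>?small. ?g a) \<le> D / (x - 1) * x ^ h / (rho * ?q ^ h)"
    proof (rule sum_pairs_le[OF KC D x])
      \<comment> \<open>The denominators of \<open>b\<close> and \<open>b - a\<close> share
        everything except \<open>C\<close> and the new primes, so the size condition compares just
        these two.\<close>
      have dgC: "dg C \<le> dg (new_primes b a)" if a: "a \<in> ?small" for a
      proof -
        let ?M = "supp b - K - C"
        have eq: "supp (b - a) = (K \<union> ?M) \<union> new_primes b a" "supp b = (K \<union> ?M) \<union> C"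
          using a supp_decomp(2)[of b a] KC by auto
        have disj: "(K \<union> ?M) \<inter> new_primes b a = {}" "(K \<union> ?M) \<inter> C = {}"
          using a decomp_disjoint[of b a] KC by auto
        have sub: "K \<union> ?M \<subseteq> S" "C \<subseteq> S" using KC by (auto dest: suppD)
        have "dg (supp (b - a)) = dg (K \<union> ?M) + dg (new_primes b a)"
          unfolding eq(1) by (rule dg_union[OF sub(1) decomp_subset(3) disj(1)])
        moreover have "dg (supp b) = dg (K \<union> ?M) + dg C"
          by (subst eq(2)) (rule dg_union[OF sub disj(2)])
        ultimately show ?thesis using a by simp
      qed
      show "?small \<subseteq> {a \<in> lowdeg (degree Q - h). a \<noteq> 0 \<and> shared_primes b a = K \<and> cancelled_primes b a = C
        \<and> dg C \<le> dg (new_primes b a) \<and> dg (new_primes b a) < h}"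
      proof (rule subsetI)
        fix a assume a: "a \<in> ?small"
        from a dgC[OF a] show "a \<in> {a \<in> lowdeg (degree Q - h). a \<noteq> 0 \<and> shared_primes b a = K \<and> cancelled_primes b a = C
        \<and> dg C \<le> dg (new_primes b a) \<and> dg (new_primes b a) < h}" by simp
      qed
    qed
    have "(\<Sum>a\<in>?AKC. ?g a) \<le> (1 / rho) ^ (1 + ?m) / ?q ^ h + D / (x - 1) * x ^ h / (rho * ?q ^ h)"
      unfolding sum_split by (rule add_mono[OF big small])
    also have "(1 / rho) ^ (1 + ?m) / ?q ^ h + D / (x - 1) * x ^ h / (rho * ?q ^ h)
       \<le> (1 + D / (x - 1)) * (x ^ h / ?q ^ h) * (1 / rho) ^ (1 + i * j)"
    proof -
      have r: "1 / rho \<ge> 1" using rho_pos rho_le_1 by simp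
      let ?R = "(1 / rho) ^ (1 + ?m)" and ?E = "D / (x - 1)"
      have R: "1 / rho \<le> ?R" "0 \<le> ?R"
        using r power_increasing[of 1 "1 + ?m" "1 / rho"] by (auto simp del: power_Suc)
      have "1 * ?R \<le> x ^ h * ?R" using x R(2) by (intro mult_right_mono) auto
      moreover have "?E * x ^ h * (1 / rho) \<le> ?E * x ^ h * ?R"
        using D(2) x R(1) by (intro mult_left_mono) auto
      ultimately have "(1 * ?R + ?E * x ^ h * (1 / rho)) / ?q ^ h \<le> (x ^ h * ?R + ?E * x ^ h * ?R) / ?q ^ h"
        by (intro divide_right_mono add_mono) auto
      also have "\<dots> = (1 + ?E) * (x ^ h / ?q ^ h) * ?R"
        by (simp add: algebra_simps)
      finally show ?thesis by (simp add: add_divide_distrib)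
    qed
    finally show "(\<Sum>a\<in>?AKC. ?g a)
      \<le> (1 + D / (x - 1)) * (x ^ h / ?q ^ h) * (1 / rho) ^ (1 + i * j)"
      by simp
  qed auto
  finally show ?thesis .
qed

text \<open>The diagonal sum: a denominator of degree at least \<open>h\<close> has at most the
  expected number of numerators, and a smaller one has none.\<close>

lemma sum_wt_mult_wt_le:
  "(\<Sum>a\<in>lowdeg (degree Q - h). wt i a * wt j a) \<le> (1 / rho) ^ (1 + i * j) / real CARD('a) ^ h"
proof -
  let ?q = "real CARD('a)"
  let ?V = "lowdeg (degree Q - h) - {0} :: 'a poly set"
  let ?g = "\<lambda>Y. real (i * j) ^ card Y / (totient_prod Y)\<^sup>2"
  have fin: "finite ?V" "finite (Pow S)" by auto
  have "(\<Sum>a\<in>lowdeg (degree Q - h). wt i a * wt j a) = (\<Sum>a\<in>?V. wt i a * wt j a)"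
    by (intro sum.mono_neutral_right) auto
  also have "\<dots> = (\<Sum>a\<in>?V. ?g (supp a))"
    by (intro sum.cong) (auto simp: wt_def power_mult_distrib power2_eq_square)
  also have "\<dots> = (\<Sum>Y\<in>Pow S. \<Sum>a | a \<in> ?V \<and> supp a = Y. ?g (supp a))"
    by (rule sum.group[symmetric, OF fin]) (auto dest: suppD)
  also have "\<dots> \<le> (\<Sum>Y\<in>Pow S. ?q ^ dg Y / ?q ^ h * ?g Y)"
  proof (intro sum_mono)
    fix Y assume Y: "Y \<in> Pow S"
    let ?F = "{a \<in> ?V. supp a = Y}"
    have img: "cofactor ` ?F \<subseteq> lowdeg (dg Y - h) - {0}"
    proof (rule image_subsetI)
      fix a assume "a \<in> ?F"
      then show "cofactor a \<in> lowdeg (dg Y - h) - {0}"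
        using cofactor_lowdeg[of a h] by simp
    qed
    have inj: "inj_on cofactor ?F"
    proof (rule inj_onI)
      fix a a' assume "a \<in> ?F" "a' \<in> ?F" "cofactor a = cofactor a'"
      then show "a = a'" using cofactor_mult[of a] cofactor_mult[of a'] by simp
    qed
    have crd: "card ?F \<le> card (lowdeg (dg Y - h) - {0 :: 'a poly})"
      by (rule card_inj_on_le[OF inj img]) simp
    have "real (card ?F) \<le> ?q ^ dg Y / ?q ^ h"
    proof (cases "h \<le> dg Y")
      case True
      have "card ?F \<le> CARD('a) ^ (dg Y - h)"
        unfolding card_lowdeg[symmetric] by (rule order.trans[OF crd card_Diff1_le])
      then have "real (card ?F) \<le> ?q ^ (dg Y - h)"
        unfolding of_nat_power[symmetric] of_nat_le_iff .
      then show ?thesis using True by (simp add: power_diff)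
    next
      case False
      \<comment> \<open>The expected number is below 1 here, so it matters that the zero numerator
        was removed.\<close>
      then have "dg Y - h = 0" by simp
      from crd[unfolded this] have "card ?F \<le> card (lowdeg 0 - {0 :: 'a poly})" .
      also have "\<dots> = 0" by simp
      finally have "card ?F = 0" by (simp only: le_zero_eq)
      then show ?thesis by (simp only: of_nat_0) simp
    qed
    then have "real (card ?F) * ?g Y \<le> ?q ^ dg Y / ?q ^ h * ?g Y"
      by (intro mult_right_mono) auto
    then show "(\<Sum>a | a \<in> ?V \<and> supp a = Y. ?g (supp a)) \<le> ?q ^ dg Y / ?q ^ h * ?g Y"
      by simp
  qed
  also have "\<dots> = (\<Sum>Y\<in>Pow S. ?q ^ (dg {} + dg Y) * (real (i * j) ^ card Y / (totient_prod ({} :: 'a poly set) * (totient_prod Y)\<^sup>2))) / ?q ^ h"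
    by (simp add: sum_divide_distrib dg_def totient_prod_def mult_ac)
  also have "\<dots> \<le> (1 / rho) ^ (1 + i * j) / ?q ^ h"
    by (intro divide_right_mono sum_weights_le) auto
  finally show ?thesis .
qed

end

section \<open>The fifth moment\<close>

text \<open>The zero row and column are split off because the bounds for fixed \<open>b\<close>, and
  the one for the convolution at \<open>c\<close>, require nonzero frequencies.\<close>

lemma sum_symmetric_le:
  fixes F :: "'b::zero \<Rightarrow> 'b \<Rightarrow> real" and d :: "'b \<Rightarrow> nat"
  assumes "finite V" "0 \<in> V" and sym: "\<And>b c. F b c = F c b" and nonneg: "\<And>b c. F b c \<ge> 0"
  shows "(\<Sum>b\<in>V. \<Sum>c\<in>V. F b c)
    \<le> 2 * (\<Sum>c\<in>V. F 0 c) + 2 * (\<Sum>b\<in>V - {0}. \<Sum>c | c \<in> V - {0} \<and> d b \<le> d c. F b c)"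
proof -
  define G where "G b c = (if b \<noteq> 0 \<and> c \<noteq> 0 \<and> d b \<le> d c then F b c else 0)" for b c
  have "(\<Sum>b\<in>V. \<Sum>c\<in>V. F b c)
    \<le> (\<Sum>b\<in>V. \<Sum>c\<in>V. (if b = 0 then F b c else 0) + (if c = 0 then F b c else 0) + G b c + G c b)"
    using nonneg sym by (intro sum_mono) (auto simp: G_def)
  also have "\<dots> = (\<Sum>b\<in>V. \<Sum>c\<in>V. if b = 0 then F b c else 0) + (\<Sum>b\<in>V. \<Sum>c\<in>V. if c = 0 then F b c else 0)
     + (\<Sum>b\<in>V. \<Sum>c\<in>V. G b c) + (\<Sum>b\<in>V. \<Sum>c\<in>V. G c b)"
    by (simp only: sum.distrib)
  also have "(\<Sum>b\<in>V. \<Sum>c\<in>V. if b = 0 then F b c else 0) = (\<Sum>c\<in>V. F 0 c)"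
    using assms(1,2) by (subst sum.swap) simp
  also have "(\<Sum>b\<in>V. \<Sum>c\<in>V. if c = 0 then F b c else 0) = (\<Sum>c\<in>V. F 0 c)"
    using assms(1,2) sym[of _ 0] by simp
  also have "(\<Sum>b\<in>V. \<Sum>c\<in>V. G c b) = (\<Sum>b\<in>V. \<Sum>c\<in>V. G b c)"
    by (rule sum.swap)
  also have "(\<Sum>b\<in>V. \<Sum>c\<in>V. G b c) = (\<Sum>b\<in>V - {0}. \<Sum>c\<in>V. G b c)"
    using assms(1) by (intro sum.mono_neutral_right) (auto simp: G_def)
  also have "\<dots> = (\<Sum>b\<in>V - {0}. \<Sum>c | c \<in> V - {0} \<and> d b \<le> d c. F b c)"
    using assms(1) by (intro sum.cong refl sum.mono_neutral_cong_right) (auto simp: G_def)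
  finally show ?thesis by simp
qed

section \<open>Savings in sums over three and over five frequencies\<close>

context prime_poly_set
begin

lemma rho_inverse_ge_1: "1 / rho \<ge> 1"
  using rho_pos rho_le_1 by simp

lemma rho_nonneg [simp]: "rho \<ge> 0"
  using rho_pos by simp

lemma wt_minus_commute: "wt j (a - b) = wt j (b - a)"
  using wt_uminus[of j "a - b"] by simp

context
  fixes h :: nat and x D :: real
  assumes x: "x > 1" and D: "\<And>W. W \<subseteq> S \<Longrightarrow> 14 ^ card W \<le> D * x ^ dg W" "D \<ge> 1"
begin

abbreviation (input) V where "V \<equiv> lowdeg (degree Q - h)"

text \<open>The factor won by each summation over the larger denominator. The 1 stems from the case
  of large moduli, \<open>D / (x - 1)\<close> from the geometric series.\<close>

definition gain :: real where
  "gain = (1 + D / (x - 1)) * (x ^ h / real CARD('a) ^ h)"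

lemma gain_ge: "1 / real CARD('a) ^ h \<le> gain"
proof -
  have "1 * (1 / real CARD('a) ^ h) \<le> (1 + D / (x - 1)) * (x ^ h / real CARD('a) ^ h)"
    using x D(2) by (intro mult_mono divide_right_mono) auto
  then show ?thesis by (simp add: gain_def)
qed

lemma gain_nonneg [simp]: "gain \<ge> 0"
  using gain_ge by (rule order.trans[rotated]) simp

text \<open>The substitution \<open>c = b - a\<close>. The largest product of weight parameters
  needed is 7, whence the base 14 = 2 * 7 in the assumption on \<open>D\<close>.\<close>

lemma sum_wt_diff_larger_le:
  assumes "b \<in> V" "b \<noteq> 0" "i * j \<le> 7"
  shows "(\<Sum>c | c \<in> V \<and> dg (supp b) \<le> dg (supp c). wt i (b - c) * wt j c)
    \<le> gain * (1 / rho) ^ (1 + i * j) * wt (i * j + i + j) b"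
proof -
  have D': "(2 * real (i * j)) ^ card W \<le> D * x ^ dg W" if "W \<subseteq> S" for W
  proof -
    have "2 * real (i * j) \<le> 2 * 7"
      using of_nat_mono[OF assms(3), where 'a = real] by (intro mult_left_mono) simp_all
    then have "(2 * real (i * j)) ^ card W \<le> 14 ^ card W"
      by (intro power_mono) auto
    also have "\<dots> \<le> D * x ^ dg W" by (rule D(1)[OF that])
    finally show ?thesis .
  qed
  have "(\<Sum>c | c \<in> V \<and> dg (supp b) \<le> dg (supp c). wt i (b - c) * wt j c)
    = (\<Sum>a | a \<in> V \<and> dg (supp b) \<le> dg (supp (b - a)). wt i a * wt j (b - a))"
    using assms(1)
    by (intro sum.reindex_bij_witness[where i = "\<lambda>a. b - a" and j = "\<lambda>c. b - c"]) auto
  also have "\<dots> \<le> gain * (1 / rho) ^ (1 + i * j) * wt (i * j + i + j) b"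
    unfolding gain_def by (rule sum_wt_larger_le[OF assms(2) D' D(2) x])
  finally show ?thesis .
qed

text \<open>Of \<open>a\<close> and \<open>b\<close>, the one with the smaller denominator is kept
  fixed and the other is summed with a gain; the diagonal sum then yields the second saving. Both
  cases end with the same exponent: (1 + j) + (2 j + 2) and 2 + (1 + 3 j).\<close>

lemma sum_conv_mult_wt_le:
  assumes "j \<le> 7"
  shows "(\<Sum>b\<in>V. conv h (wt 1) b * wt j b) \<le> 2 * gain * (1 / rho) ^ (3 * j + 3) / real CARD('a) ^ h"
proof -
  let ?q = "real CARD('a)" and ?d = "\<lambda>a. dg (supp a)" and ?P = "1 / rho"
  let ?t = "\<lambda>a b. wt 1 a * wt 1 (b - a) * wt j b"
  have "(\<Sum>b\<in>V. conv h (wt 1) b * wt j b) = (\<Sum>b\<in>V. \<Sum>a\<in>V. ?t a b)"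
    by (simp add: conv_def sum_distrib_right)
  also have "\<dots> \<le> (\<Sum>b\<in>V. \<Sum>a\<in>V. (if ?d a \<le> ?d b then ?t a b else 0) + (if ?d b \<le> ?d a then ?t a b else 0))"
    by (intro sum_mono) auto
  also have "\<dots> = (\<Sum>a\<in>V. \<Sum>b\<in>V. if ?d a \<le> ?d b then ?t a b else 0) + (\<Sum>b\<in>V. \<Sum>a\<in>V. if ?d b \<le> ?d a then ?t a b else 0)"
    by (simp only: sum.distrib) (subst sum.swap, rule refl)
  also have "\<dots> \<le> gain * ?P ^ (3 * j + 3) / ?q ^ h + gain * ?P ^ (3 * j + 3) / ?q ^ h"
  proof (rule add_mono)
    have "(\<Sum>a\<in>V. \<Sum>b\<in>V. if ?d a \<le> ?d b then ?t a b else 0)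
      \<le> (\<Sum>a\<in>V. gain * ?P ^ (1 + j) * (wt 1 a * wt (2 * j + 1) a))"
    proof (rule sum_mono)
      fix a :: "'a poly" assume a: "a \<in> V"
      show "(\<Sum>b\<in>V. if ?d a \<le> ?d b then ?t a b else 0) \<le> gain * ?P ^ (1 + j) * (wt 1 a * wt (2 * j + 1) a)"
      proof (cases "a = 0")
        case False
        have "(\<Sum>b\<in>V. if ?d a \<le> ?d b then ?t a b else 0) = (\<Sum>b | b \<in> V \<and> ?d a \<le> ?d b. ?t a b)"
          by (rule sum.inter_filter[symmetric]) simp
        also have "\<dots> = wt 1 a * (\<Sum>b | b \<in> V \<and> ?d a \<le> ?d b. wt 1 (a - b) * wt j b)"
          by (simp add: sum_distrib_left wt_minus_commute[of _ a] mult.assoc)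
        also have "\<dots> \<le> wt 1 a * (gain * ?P ^ (1 + 1 * j) * wt (1 * j + 1 + j) a)"
          using assms by (intro mult_left_mono sum_wt_diff_larger_le a False) auto
        also have "\<dots> = gain * ?P ^ (1 + j) * (wt 1 a * wt (2 * j + 1) a)"
        proof -
          have "1 * j + 1 + j = 2 * j + 1" by simp
          then have "wt (1 * j + 1 + j) a = wt (2 * j + 1) a" by (rule arg_cong)
          then show ?thesis by simp
        qed
        finally show ?thesis .
      next
        case True
        show ?thesis unfolding True by (simp cong: if_cong)
      qed
    qed
    also have "\<dots> = gain * ?P ^ (1 + j) * (\<Sum>a\<in>V. wt 1 a * wt (2 * j + 1) a)"
      by (simp add: sum_distrib_left)
    also have "\<dots> \<le> gain * ?P ^ (1 + j) * (?P ^ (1 + 1 * (2 * j + 1)) / ?q ^ h)"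
      using gain_nonneg rho_inverse_ge_1 by (intro mult_left_mono sum_wt_mult_wt_le) auto
    also have "\<dots> = gain * (?P ^ (1 + j) * ?P ^ (1 + 1 * (2 * j + 1))) / ?q ^ h" by (simp only: times_divide_eq_right mult.assoc)
    also have "?P ^ (1 + j) * ?P ^ (1 + 1 * (2 * j + 1)) = ?P ^ (3 * j + 3)"
      unfolding power_add[symmetric] by (rule arg_cong[where f = "\<lambda>k. ?P ^ k"]) simp
    finally show "(\<Sum>a\<in>V. \<Sum>b\<in>V. if ?d a \<le> ?d b then ?t a b else 0) \<le> gain * ?P ^ (3 * j + 3) / ?q ^ h" .
  next
    have "(\<Sum>b\<in>V. \<Sum>a\<in>V. if ?d b \<le> ?d a then ?t a b else 0)
      \<le> (\<Sum>b\<in>V. gain * ?P ^ 2 * (wt 3 b * wt j b))"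
    proof (rule sum_mono)
      fix b :: "'a poly" assume b: "b \<in> V"
      show "(\<Sum>a\<in>V. if ?d b \<le> ?d a then ?t a b else 0) \<le> gain * ?P ^ 2 * (wt 3 b * wt j b)"
      proof (cases "b = 0")
        case False
        have "(\<Sum>a\<in>V. if ?d b \<le> ?d a then ?t a b else 0) = (\<Sum>a | a \<in> V \<and> ?d b \<le> ?d a. ?t a b)"
          by (rule sum.inter_filter[symmetric]) simp
        also have "\<dots> = wt j b * (\<Sum>a | a \<in> V \<and> ?d b \<le> ?d a. wt 1 (b - a) * wt 1 a)"
          by (simp add: sum_distrib_left mult_ac)
        also have "\<dots> \<le> wt j b * (gain * ?P ^ (1 + 1 * 1) * wt (1 * 1 + 1 + 1) b)"
          by (intro mult_left_mono sum_wt_diff_larger_le b False) auto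
        also have "\<dots> = gain * ?P ^ 2 * (wt 3 b * wt j b)"
          by (simp add: numeral_3_eq_3 numeral_2_eq_2)
        finally show ?thesis .
      next
        case True
        show ?thesis unfolding True by (simp cong: if_cong)
      qed
    qed
    also have "\<dots> = gain * ?P ^ 2 * (\<Sum>b\<in>V. wt 3 b * wt j b)"
      by (simp add: sum_distrib_left)
    also have "\<dots> \<le> gain * ?P ^ 2 * (?P ^ (1 + 3 * j) / ?q ^ h)"
      using gain_nonneg rho_inverse_ge_1 by (intro mult_left_mono sum_wt_mult_wt_le) auto
    also have "\<dots> = gain * (?P ^ 2 * ?P ^ (1 + 3 * j)) / ?q ^ h" by (simp only: times_divide_eq_right mult.assoc)
    also have "?P ^ 2 * ?P ^ (1 + 3 * j) = ?P ^ (3 * j + 3)"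
      unfolding power_add[symmetric] by (rule arg_cong[where f = "\<lambda>k. ?P ^ k"]) simp
    finally show "(\<Sum>b\<in>V. \<Sum>a\<in>V. if ?d b \<le> ?d a then ?t a b else 0) \<le> gain * ?P ^ (3 * j + 3) / ?q ^ h" .
  qed
  finally show ?thesis by simp
qed

text \<open>The convolution at \<open>c\<close> becomes a weight with parameter 3, and summing over
  \<open>c\<close> produces 7 = 1 * 3 + 1 + 3. The exponent is 30 = 2 + 4 + 24, from these two moves
  and the remaining three-term sum; the terms with \<open>b = 0\<close> or \<open>c = 0\<close> need
  only 8.\<close>

lemma quintuple_sum_le:
  "(\<Sum>b\<in>V. \<Sum>c\<in>V. conv h (wt 1) b * conv h (wt 1) c * wt 1 (b - c))
    \<le> 8 * gain\<^sup>2 * (1 / rho) ^ 30 / real CARD('a) ^ h"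
proof -
  let ?q = "real CARD('a)" and ?d = "\<lambda>a. dg (supp a)" and ?P = "1 / rho"
  let ?r = "conv h (wt 1)"
  have r_nonneg: "?r b \<ge> 0" for b
    unfolding conv_def by (intro sum_nonneg) auto
  have P: "?P \<ge> 1" by (rule rho_inverse_ge_1)
  have "(\<Sum>b\<in>V. \<Sum>c\<in>V. ?r b * ?r c * wt 1 (b - c))
    \<le> 2 * (\<Sum>c\<in>V. ?r 0 * ?r c * wt 1 (0 - c))
      + 2 * (\<Sum>b\<in>V - {0}. \<Sum>c | c \<in> V - {0} \<and> ?d b \<le> ?d c. ?r b * ?r c * wt 1 (b - c))"
    using r_nonneg wt_minus_commute by (intro sum_symmetric_le) auto
  also have "\<dots> \<le> 2 * (2 * gain\<^sup>2 * ?P ^ 30 / ?q ^ h) + 2 * (2 * gain\<^sup>2 * ?P ^ 30 / ?q ^ h)"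
  proof (intro add_mono mult_left_mono)
    have "?r 0 = (\<Sum>a\<in>V. wt 1 a * wt 1 a)"
      unfolding conv_def by simp
    also have "\<dots> \<le> ?P ^ (1 + 1 * 1) / ?q ^ h"
      by (rule sum_wt_mult_wt_le)
    finally have r0: "?r 0 \<le> ?P ^ 2 * (1 / ?q ^ h)" by (simp add: numeral_2_eq_2)
    have "(\<Sum>c\<in>V. ?r 0 * ?r c * wt 1 (0 - c)) = ?r 0 * (\<Sum>c\<in>V. ?r c * wt 1 c)"
      by (simp add: sum_distrib_left mult.assoc)
    also have "\<dots> \<le> (?P ^ 2 * gain) * (2 * gain * ?P ^ (3 * 1 + 3) / ?q ^ h)"
    proof (rule mult_mono)
      show "?r 0 \<le> ?P ^ 2 * gain"
        using P by (intro order.trans[OF r0] mult_left_mono gain_ge) auto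
      show "(\<Sum>c\<in>V. ?r c * wt 1 c) \<le> 2 * gain * ?P ^ (3 * 1 + 3) / ?q ^ h"
        by (rule sum_conv_mult_wt_le) simp
    qed (use r_nonneg in \<open>auto intro!: sum_nonneg\<close>)
    also have "\<dots> = 2 * gain\<^sup>2 * (?P ^ 2 * ?P ^ (3 * 1 + 3)) / ?q ^ h"
      by (simp only: power2_eq_square[of gain] times_divide_eq_right mult_ac)
    also have "?P ^ 2 * ?P ^ (3 * 1 + 3) = ?P ^ 8"
      unfolding power_add[symmetric] by simp
    also have "2 * gain\<^sup>2 * ?P ^ 8 / ?q ^ h \<le> 2 * gain\<^sup>2 * ?P ^ 30 / ?q ^ h"
      using P by (intro divide_right_mono mult_left_mono power_increasing) auto
    finally show "(\<Sum>c\<in>V. ?r 0 * ?r c * wt 1 (0 - c)) \<le> 2 * gain\<^sup>2 * ?P ^ 30 / ?q ^ h" .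
  next
    have "(\<Sum>b\<in>V - {0}. \<Sum>c | c \<in> V - {0} \<and> ?d b \<le> ?d c. ?r b * ?r c * wt 1 (b - c))
      \<le> (\<Sum>b\<in>V - {0}. gain * ?P ^ 6 * (?r b * wt 7 b))"
    proof (rule sum_mono)
      fix b :: "'a poly" assume b: "b \<in> V - {0}"
      have "(\<Sum>c | c \<in> V - {0} \<and> ?d b \<le> ?d c. ?r b * ?r c * wt 1 (b - c))
        \<le> (\<Sum>c | c \<in> V - {0} \<and> ?d b \<le> ?d c. ?r b * ?P ^ 2 * (wt 1 (b - c) * wt 3 c))"
      proof (rule sum_mono)
        fix c assume "c \<in> {c \<in> V - {0}. ?d b \<le> ?d c}"
        then have "?r b * ?r c * wt 1 (b - c) \<le> ?r b * (?P ^ 2 * wt 3 c) * wt 1 (b - c)"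
          by (intro mult_right_mono mult_left_mono conv_wt_1_le r_nonneg) auto
        then show "?r b * ?r c * wt 1 (b - c) \<le> ?r b * ?P ^ 2 * (wt 1 (b - c) * wt 3 c)"
          by (simp only: mult_ac)
      qed
      also have "\<dots> \<le> (\<Sum>c | c \<in> V \<and> ?d b \<le> ?d c. ?r b * ?P ^ 2 * (wt 1 (b - c) * wt 3 c))"
        using r_nonneg by (intro sum_mono2) auto
      also have "\<dots> = ?r b * ?P ^ 2 * (\<Sum>c | c \<in> V \<and> ?d b \<le> ?d c. wt 1 (b - c) * wt 3 c)"
        by (simp only: sum_distrib_left)
      also have "\<dots> \<le> ?r b * ?P ^ 2 * (gain * ?P ^ (1 + 1 * 3) * wt (1 * 3 + 1 + 3) b)"
        using b r_nonneg P by (intro mult_left_mono sum_wt_diff_larger_le) auto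
      also have "\<dots> = gain * (?P ^ 2 * ?P ^ (1 + 1 * 3)) * (?r b * wt (1 * 3 + 1 + 3) b)"
        by (simp only: mult_ac)
      also have "?P ^ 2 * ?P ^ (1 + 1 * 3) = ?P ^ 6"
        unfolding power_add[symmetric] by simp
      finally show "(\<Sum>c | c \<in> V - {0} \<and> ?d b \<le> ?d c. ?r b * ?r c * wt 1 (b - c)) \<le> gain * ?P ^ 6 * (?r b * wt 7 b)"
        by simp
    qed
    also have "\<dots> \<le> (\<Sum>b\<in>V. gain * ?P ^ 6 * (?r b * wt 7 b))"
      using gain_nonneg P r_nonneg by (intro sum_mono2) auto
    also have "\<dots> = gain * ?P ^ 6 * (\<Sum>b\<in>V. ?r b * wt 7 b)"
      by (simp only: sum_distrib_left)
    also have "\<dots> \<le> gain * ?P ^ 6 * (2 * gain * ?P ^ (3 * 7 + 3) / ?q ^ h)"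
      using gain_nonneg P by (intro mult_left_mono sum_conv_mult_wt_le) auto
    also have "\<dots> = 2 * gain\<^sup>2 * (?P ^ 6 * ?P ^ (3 * 7 + 3)) / ?q ^ h"
      by (simp only: power2_eq_square[of gain] times_divide_eq_right mult_ac)
    also have "?P ^ 6 * ?P ^ (3 * 7 + 3) = ?P ^ 30"
      unfolding power_add[symmetric] by simp
    finally show "(\<Sum>b\<in>V - {0}. \<Sum>c | c \<in> V - {0} \<and> ?d b \<le> ?d c. ?r b * ?r c * wt 1 (b - c))
      \<le> 2 * gain\<^sup>2 * ?P ^ 30 / ?q ^ h" .
  qed simp_all
  finally show ?thesis by simp
qed

end

end

context prime_poly_set_character
begin

text \<open>Two gains and the diagonal saving reduce \<open>q ^ (5 * h)\<close> to
  \<open>q ^ (2 * h)\<close>, and five powers of \<open>rho\<close> reduce the exponent 30 to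
  25.\<close>

lemma reduced_moment_5_bound:
  assumes x: "x > 1" and D: "\<And>W. W \<subseteq> S \<Longrightarrow> 14 ^ card W \<le> D * x ^ dg W" "D \<ge> 1"
  shows "\<bar>reduced_moment 5 Q h\<bar> \<le> 8 * (1 + D / (x - 1))\<^sup>2 *
    (real (poly_abs Q) * real CARD('a) ^ (2 * h) * (x ^ h)\<^sup>2 * (real (poly_abs Q) / real (poly_phi Q)) ^ 25)"
proof -
  let ?q = "real CARD('a)" and ?E = "1 + D / (x - 1)"
  have q: "?q > 0" using CARD_real_gt_1 by linarith
  have "\<bar>reduced_moment 5 Q h\<bar> \<le> ?q ^ degree Q * (?q ^ h) ^ 5 * rho ^ 5 *
      (\<Sum>b\<in>lowdeg (degree Q - h). \<Sum>c\<in>lowdeg (degree Q - h). conv h (wt 1) b * conv h (wt 1) c * wt 1 (b - c))"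
    by (rule abs_reduced_moment_5_le)
  also have "\<dots> \<le> ?q ^ degree Q * (?q ^ h) ^ 5 * rho ^ 5 * (8 * (gain h x D)\<^sup>2 * (1 / rho) ^ 30 / ?q ^ h)"
    using rho_pos by (intro mult_left_mono quintuple_sum_le x D) auto
  also have "\<dots> = 8 * ?E\<^sup>2 * (?q ^ degree Q * ?q ^ (2 * h) * (x ^ h)\<^sup>2 * (1 / rho) ^ 25)"
  proof -
    have "n * N ^ 5 * r ^ 5 * (8 * (E * (y / N))\<^sup>2 * (1 / r) ^ 30 / N) = 8 * E\<^sup>2 * (n * N\<^sup>2 * y\<^sup>2 * (1 / r) ^ 25)"
      if "N > 0" "r > 0" for n N r E y :: real
    proof -
      have "r ^ 5 * (1 / r) ^ 30 = (1 / r) ^ 25"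
        using that by (simp add: power_one_over field_simps flip: power_add)
      moreover have "N ^ 5 * ((y / N)\<^sup>2 / N) = N\<^sup>2 * y\<^sup>2"
        using that by (simp add: field_simps eval_nat_numeral)
      moreover have "n * N ^ 5 * r ^ 5 * (8 * (E * (y / N))\<^sup>2 * (1 / r) ^ 30 / N)
        = 8 * E\<^sup>2 * (n * (N ^ 5 * ((y / N)\<^sup>2 / N)) * (r ^ 5 * (1 / r) ^ 30))"
        unfolding power_mult_distrib[of E] by simp
      ultimately show ?thesis by (simp add: mult.assoc)
    qed
    from this[of "?q ^ h" rho "?q ^ degree Q" ?E "x ^ h"] show ?thesis
      using q rho_pos gain_def[OF x D] by (simp add: power_mult[symmetric] mult.commute[of h])
  qed
  also have "1 / rho = real (poly_abs Q) / real (poly_phi Q)"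
    using q by (simp add: poly_phi_Q poly_abs_Q)
  also have "?q ^ degree Q = real (poly_abs Q)" by (simp add: poly_abs_Q)
  finally show ?thesis .
qed

end

section \<open>Factorisation of squarefree monic polynomials, and the final estimate\<close>

lemma monic_irreducible_divisor:
  fixes Q :: "'a::field poly"
  assumes "lead_coeff Q = 1" "degree Q > 0"
  shows "\<exists>p. irreducible p \<and> lead_coeff p = 1 \<and> p dvd Q"
proof -
  let ?P = "\<lambda>p. p dvd Q \<and> lead_coeff p = 1 \<and> degree p > 0"
  \<comment> \<open>A nonconstant monic divisor of least degree is irreducible, since a proper
    factor could be made monic.\<close>
  obtain p where p: "?P p" and min: "\<And>r. ?P r \<Longrightarrow> degree p \<le> degree r"
    using ex_has_least_nat[of ?P Q degree] assms by auto
  have "p \<noteq> 0" using p by auto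
  have "irreducible p"
  proof (rule irreducibleI)
    show "p \<noteq> 0" by fact
    show "\<not> is_unit p" using p \<open>p \<noteq> 0\<close> by (simp add: is_unit_iff_degree)
    fix a b assume ab: "p = a * b"
    then have ne: "a \<noteq> 0" "b \<noteq> 0" using \<open>p \<noteq> 0\<close> by auto
    show "is_unit a \<or> is_unit b"
    proof (rule ccontr)
      assume "\<not> (is_unit a \<or> is_unit b)"
      then have deg: "degree a > 0" "degree b > 0" using ne by (auto simp: is_unit_iff_degree)
      have "?P (smult (inverse (lead_coeff a)) a)"
        using ne deg p ab by (auto simp: smult_dvd_iff intro: dvd_trans)
      from min[OF this] show False
        using ne deg ab by (simp add: degree_mult_eq)
    qed
  qed
  then show ?thesis using p by blast
qed

lemma squarefree_monic_eq_prod: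
  fixes Q :: "'a::field poly"
  assumes "lead_coeff Q = 1" "squarefree Q"
  shows "\<exists>S. finite S \<and> (\<forall>p\<in>S. irreducible p \<and> lead_coeff p = 1) \<and> Q = \<Prod>S"
  using assms
proof (induction "degree Q" arbitrary: Q rule: less_induct)
  case less
  show ?case
  proof (cases "degree Q = 0")
    case True
    then have "Q = 1" using less.prems(1) by (auto elim!: degree_eq_zeroE simp: one_pCons)
    then show ?thesis by (intro exI[of _ "{}"]) simp
  next
    case False
    then obtain p where p: "irreducible p" "lead_coeff p = 1" "p dvd Q"
      using monic_irreducible_divisor[OF less.prems(1)] by auto
    then obtain R where R: "Q = p * R" by (auto elim: dvdE)
    have ne: "p \<noteq> 0" "R \<noteq> 0" using R less.prems(1) by auto
    have nu: "\<not> is_unit p" using p(1) by (simp add: irreducible_def)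
    have "degree R < degree Q"
      using ne nu unfolding R by (simp add: degree_mult_eq is_unit_iff_degree)
    moreover have "lead_coeff R = 1" using less.prems(1) p(2) by (simp add: R lead_coeff_mult)
    moreover have "squarefree R" using less.prems(2) by (rule squarefree_mono[rotated]) (simp add: R)
    ultimately obtain S where S: "finite S" "\<And>p. p \<in> S \<Longrightarrow> irreducible p \<and> lead_coeff p = 1" "R = \<Prod>S"
      using less.hyps by blast
    have "p \<notin> S"
    proof
      assume "p \<in> S"
      then have "p dvd R" unfolding S(3) using dvd_prodI[OF S(1), of p "\<lambda>p. p"] by simp
      then have "p ^ 2 dvd Q" by (simp add: R power2_eq_square mult_dvd_mono)
      then show False using squarefreeD[OF less.prems(2)] nu by blast
    qed
    then show ?thesis using S p R by (intro exI[of _ "insert p S"]) auto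
  qed
qed

theorem theorem4p6:
  fixes \<epsilon> :: real
  assumes "\<epsilon> > 0"
  shows "\<exists>C>0. \<forall>(Q :: 'a::{finite,field} poly) (h :: nat).
           lead_coeff Q = 1 \<longrightarrow> squarefree Q \<longrightarrow>
           \<bar>reduced_moment 5 Q h\<bar> \<le> C *
             (real (poly_abs Q) * real CARD('a) powr ((2 + \<epsilon>) * real h)
                * (real (poly_abs Q) / real (poly_phi Q)) powi (- 4)
              + real (poly_abs Q) * real CARD('a) ^ (2 * h)
                * (real (poly_abs Q) / real (poly_phi Q)) ^ 27)"
proof -
  let ?q = "real CARD('a)"
  have q: "?q > 1" using CARD_field_ge_2[where 'a = 'a] by simp
  \<comment> \<open>31 = 2 + 29: two powers of \<open>x ^ h\<close> are present in the moment bound,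
    and 29 more replace powers of \<open>P\<close> below.\<close>
  define x where "x = ?q powr (\<epsilon> / 31)"
  have x: "x > 1" using q assms by (simp add: x_def)
  \<comment> \<open>\<open>D\<close> is chosen before \<open>Q\<close> and \<open>h\<close>, so the
    final constant depends on epsilon and the field only.\<close>
  obtain D where D: "D \<ge> 1"
    "\<And>W :: 'a poly set. finite W \<Longrightarrow> 0 \<notin> W \<Longrightarrow> 14 ^ card W \<le> D * x ^ degree (\<Prod>W)"
    using power_card_le[of 14 x, where 'a = 'a] x by auto
  define C where "C = 8 * (1 + D / (x - 1))\<^sup>2"
  have C: "C > 0"
    using x D(1) unfolding C_def by (intro mult_pos_pos zero_less_power add_pos_nonneg) auto
  obtain \<psi> :: "'a \<Rightarrow> complex" where \<psi>: "\<psi> 0 = 1" "\<And>x y. \<psi> (x + y) = \<psi> x * \<psi> y" "\<exists>x. \<psi> x \<noteq> 1"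
    using exists_nontrivial_additive_character by blast
  have "\<bar>reduced_moment 5 Q h\<bar> \<le> C *
             (real (poly_abs Q) * ?q powr ((2 + \<epsilon>) * real h) * (real (poly_abs Q) / real (poly_phi Q)) powi (- 4)
              + real (poly_abs Q) * ?q ^ (2 * h) * (real (poly_abs Q) / real (poly_phi Q)) ^ 27)"
    if Q: "lead_coeff Q = 1" "squarefree Q" for Q :: "'a poly" and h :: nat
  proof -
    obtain S where S: "finite S" "\<And>p. p \<in> S \<Longrightarrow> irreducible p \<and> lead_coeff p = 1" "Q = \<Prod>S"
      using squarefree_monic_eq_prod[OF Q] by blast
    interpret prime_poly_set_character S \<psi>
      by unfold_locales (use S \<psi> in auto)
    define P where "P = real (poly_abs Q) / real (poly_phi Q)"
    have "1 / rho = P"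
      using q by (simp add: P_def S(3) poly_phi_Q poly_abs_Q)
    then have P: "P \<ge> 1" using rho_inverse_ge_1 by simp
    have DW: "14 ^ card W \<le> D * x ^ dg W" if "W \<subseteq> S" for W
      unfolding dg_def using that S_nonzero by (intro D(2)) auto
    \<comment> \<open>If \<open>x ^ h \<le> P\<close>, the two factors \<open>x ^ h\<close> become
      the powers 26 and 27 of \<open>P\<close>. Otherwise \<open>P ^ 29\<close> is at most
      \<open>(x ^ h) ^ 29\<close>, which leaves \<open>P ^ 4\<close> in the denominator.\<close>
    have "(x ^ h)\<^sup>2 * P ^ 25 \<le> x ^ (31 * h) / P ^ 4 + P ^ 27"
    proof (cases "x ^ h \<le> P")
      case True
      then have "(x ^ h)\<^sup>2 * P ^ 25 \<le> P\<^sup>2 * P ^ 25"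
        using x P by (intro mult_right_mono power_mono) auto
      also have "\<dots> = P ^ 27" unfolding power_add[symmetric] by simp
      finally show ?thesis using x P by (intro add_increasing) auto
    next
      case False
      then have "(x ^ h)\<^sup>2 * P ^ 29 \<le> (x ^ h)\<^sup>2 * (x ^ h) ^ 29"
        using x P by (intro mult_left_mono power_mono) auto
      also have "\<dots> = x ^ (31 * h)"
        by (simp add: mult.commute flip: power_add power_mult)
      finally have "(x ^ h)\<^sup>2 * P ^ 29 / P ^ 4 \<le> x ^ (31 * h) / P ^ 4"
        using P by (intro divide_right_mono) auto
      moreover have "P ^ 29 = P ^ 25 * P ^ 4" unfolding power_add[symmetric] by simp
      then have "(x ^ h)\<^sup>2 * P ^ 29 / P ^ 4 = (x ^ h)\<^sup>2 * P ^ 25 * P ^ 4 / P ^ 4"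
        by (simp only: mult.assoc)
      then have "(x ^ h)\<^sup>2 * P ^ 29 / P ^ 4 = (x ^ h)\<^sup>2 * P ^ 25"
        using P by (subst (asm) nonzero_mult_div_cancel_right) auto
      moreover have "P ^ 27 \<ge> 0" using P by simp
      ultimately show ?thesis by linarith
    qed
    then have "real (poly_abs Q) * ?q ^ (2 * h) * ((x ^ h)\<^sup>2 * P ^ 25)
       \<le> real (poly_abs Q) * ?q ^ (2 * h) * (x ^ (31 * h) / P ^ 4 + P ^ 27)"
      by (intro mult_left_mono) auto
    also have "\<dots> = real (poly_abs Q) * (?q ^ (2 * h) * x ^ (31 * h)) * (1 / P ^ 4)
        + real (poly_abs Q) * ?q ^ (2 * h) * P ^ 27"
      by (simp add: distrib_left mult.assoc)
    also have "?q ^ (2 * h) * x ^ (31 * h) = ?q powr ((2 + \<epsilon>) * real h)"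
    proof -
      have "x ^ (31 * h) = ?q powr (\<epsilon> * real h)"
        using q by (simp add: x_def powr_powr flip: powr_realpow)
      moreover have "?q ^ (2 * h) = ?q powr (2 * real h)"
        using q by (simp flip: powr_realpow)
      ultimately show ?thesis by (simp add: distrib_right powr_add)
    qed
    also have "1 / P ^ 4 = P powi (- 4)"
      by (simp only: power_int_minus power_int_numeral inverse_eq_divide)
    finally have "C * (real (poly_abs Q) * ?q ^ (2 * h) * ((x ^ h)\<^sup>2 * P ^ 25))
      \<le> C * (real (poly_abs Q) * ?q powr ((2 + \<epsilon>) * real h) * P powi (- 4)
        + real (poly_abs Q) * ?q ^ (2 * h) * P ^ 27)"
      using C by (intro mult_left_mono) auto
    moreover have "\<bar>reduced_moment 5 Q h\<bar> \<le> C * (real (poly_abs Q) * ?q ^ (2 * h) * ((x ^ h)\<^sup>2 * P ^ 25))"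
      using reduced_moment_5_bound[OF x DW D(1), of h] by (simp only: C_def P_def S(3) mult.assoc)
    ultimately show ?thesis unfolding P_def[symmetric] by (rule order.trans[rotated])
  qed
  with C show ?thesis by blast
qed

end
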